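(* Let $\mathcal{D}$ be a domain in $\mathbb{C}^{2n}_*$ and let $\{\mathcal{D}_\alpha\}_{\alpha\in\mathfrak{A}}$ be a finite open covering of $\mathcal{D}$. Let $\{F_\alpha(\boldsymbol{t})\}_{\alpha\in\mathfrak{A}}$ and $\{G_\alpha(\boldsymbol{t})\}_{\alpha\in\mathfrak{A}}$ be collections of, respectively, $\mathbb{C}^{m\times n}$-valued and $\mathbb{C}^{n\times m}$-valued functions satisfying the following conditions: 1. For each $\alpha\in\mathfrak{A}$ the functions $F_\alpha(\boldsymbol{t})$, $G_\alpha(\boldsymbol{t})$ are holomorphic in $\mathcal{D}_\alpha$. 2. Whenever $\mathcal{D}_{\alpha'}\cap\mathcal{D}_{\alpha''}\neq\emptyset$, there exist diagonal matrix functions $D_{r,\alpha',\alpha''}(\boldsymbol{t})$, $D_{c,\alpha',\alpha''}(\boldsymbol{t})$, holomorphic and invertible in $\mathcal{D}_{\alpha'}\cap\mathcal{D}_{\alpha''}$, such that for every $\boldsymbol{t}\in\mathcal{D}_{\alpha'}\cap\mathcal{D}_{\alpha''}$ $$F_{\alpha''}(\boldsymbol{t})=F_{\alpha'}(\boldsymbol{t})D_{c,\alpha',\alpha''}(\boldsymbol{t}),\qquad G_{\alpha''}(\boldsymbol{t})=D_{r,\alpha',\alpha''}(\boldsymbol{t})G_{\alpha'}(\boldsymbol{t}).$$ 3. The pair of collections $\{F_\alpha\}_{\alpha\in\mathfrak{A}}$, $\{G_\alpha\}_{\alpha\in\mathfrak{A}}$ is $\mathcal{ZP}$-admissible. Let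 $\{S_\alpha(\boldsymbol{t})\}_{\alpha\in\mathfrak{A}}$ be the collection of $\mathcal{ZP}$-coupling functions and $\Gamma_{\mathcal{ZP}}$ the $\mathcal{ZP}$-singular set related to this pair of collections. Then there exists a unique normalized holomorphic family $\{R(z,\boldsymbol{t})\}_{\boldsymbol{t}\in\mathcal{D}\setminus\Gamma_{\mathcal{ZP}}}$ of generic rational functions parameterized by the pole and zero loci such that for every $\alpha\in\mathfrak{A}$ and $\boldsymbol{t}\in\mathcal{D}_\alpha\setminus\Gamma_{\mathcal{ZP}}$ the matrices $F_\alpha(\boldsymbol{t})$ and $G_\alpha(\boldsymbol{t})$ are, respectively, the left pole and right zero semiresidual matrices of $R(\cdot,\boldsymbol{t})$. It is locally given by $$R(z,\boldsymbol{t})=I-F_\alpha(\boldsymbol{t})(zI-A_{\mathcal P}(\boldsymbol{t}))^{-1}S_\alpha^{-1}(\boldsymbol{t})G_\alpha(\boldsymbol{t}),\qquad \boldsymbol{t}\in\mathcal{D}_\alpha\setminus\Gamma_{\mathcal{ZP}}.$$ Furthermore, the logarithmic derivative of $R(z,\boldsymbol{t})$ with respect to $z$ admits the local representation $$\frac{\partial R(z,\boldsymbol{t})}{\partial z}R^{-1}(z,\boldsymbol{t})=F_\alpha(\boldsymbol{t})(zI-A_{\mathcal P}(\boldsymbol{t}))^{-1}S_\alpha^{-1}(\boldsymbol{t})(zI-A_{\mathcal Z}(\boldsymbol{t}))^{-1}G_\alpha(\boldsymbol{t}),\qquad \boldsymbol{t}\in\mathcal{D}_\alpha\setminus\Ga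mma_{\mathcal{ZP}}.$$
   Context: $\mathbb{C}^{2n}_*$ is the set of $\boldsymbol{t}=(t_1,\dots,t_{2n})\in\mathbb{C}^{2n}$ with pairwise distinct coordinates; $A_{\mathcal P}(\boldsymbol{t})=\mathrm{diag}(t_1,\dots,t_n)$, $A_{\mathcal Z}(\boldsymbol{t})=\mathrm{diag}(t_{n+1},\dots,t_{2n})$. Coupling functions. For $\alpha\in\mathfrak{A}$, $\boldsymbol{t}\in\mathcal{D}_\alpha$, the $\mathcal{ZP}$-coupling function $S_\alpha(\boldsymbol{t})\in\mathbb{C}^{n\times n}$ is the unique solution of the Lyapunov equation $A_{\mathcal Z}(\boldsymbol{t})S_\alpha(\boldsymbol{t})-S_\alpha(\boldsymbol{t})A_{\mathcal P}(\boldsymbol{t})=G_\alpha(\boldsymbol{t})F_\alpha(\boldsymbol{t})$; it is holomorphic in $\mathcal{D}_\alpha$. The pair of collections is $\mathcal{ZP}$-admissible if for every $\alpha\in\mathfrak{A}$, $\det S_\alpha(\boldsymbol{t})\not\equiv0$ in $\mathcal{D}_\alpha$; in that case the $\mathcal{ZP}$-singular set is $\Gamma_{\mathcal{ZP}}=\bigcup_{\alpha\in\mathfrak{A}}\{\boldsymbol{t}\in\mathcal{D}_\alpha:\det S_\alpha(\boldsymbol{t})=0\}$. Simple singular points. Let $R(z)$ be a $\mathbb{C}^{m\times m}$-valued function, holomorphic and invertible in a punctured neighborhood of $t\in\mathbb{C}$. The point $t$ is regular for $R$ if $R$ and $R^{-1}$ are both holomorphic at $t$, and singular otherwise. A singular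 point $t$ is simple if either $R$ has a simple pole at $t$ and $R^{-1}$ is holomorphic at $t$ (then $t$ is a pole of $R$), or $R^{-1}$ has a simple pole at $t$ and $R$ is holomorphic at $t$ (then $t$ is a zero of $R$). Generic rational functions. A $\mathbb{C}^{m\times m}$-valued rational function $R$ is generic if $\det R\not\equiv0$, all its singular points in $\mathbb{C}$ are simple, $\infty$ is a regular point ($R$ and $R^{-1}$ holomorphic at $\infty$), and all residues of $R$ and $R^{-1}$ at their poles have rank one. Such $R$ has equally many poles and zeros; order the poles as $t_1,\dots,t_n$ and the zeros as $t_{n+1},\dots,t_{2n}$. The pole and zero matrices are $\mathrm{diag}(t_1,\dots,t_n)$ and $\mathrm{diag}(t_{n+1},\dots,t_{2n})$. Let $R_k$ be the residue at $t_k$ of $R$ (for $1\le k\le n$), respectively of $R^{-1}$ (for $n+1\le k\le 2n$), and factor $R_k=f_kg_k$ with $f_k\in\mathbb{C}^{m\times1}$, $g_k\in\mathbb{C}^{1\times m}$ (unique up to $f_k\to f_kc$, $g_k\to c^{-1}g_k$, $c\neq0$). A matrix with columns $f_1,\dots,f_n$ is a left pole semiresidual matrix of $R$; a matrix with rows $g_{n+1},\dots,g_{2n}$ is a right zero semiresidual matrix of $R$. "$F$ is the left pole semiresidual matrix of $R$" means that $F$ arises for some choice of the factorizations; similarly for the right zero one. Families. Let $\mathcal{D}'\subseteq\mathbb{C}^{2n}_*$ be a domain. A normalized holomorphic family of generic rational functions parameterized by the pole and zero loci is a family $\{R(z,\boldsymbol{t})\}_{\boldsymbol{t}\in\mathcal{D}'}$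 such that: for each $\boldsymbol{t}\in\mathcal{D}'$, $R(\cdot,\boldsymbol{t})$ is a generic $\mathbb{C}^{m\times m}$-valued rational function with pole and zero matrices $A_{\mathcal P}(\boldsymbol{t})$, $A_{\mathcal Z}(\boldsymbol{t})$; for each $\boldsymbol{t}^0\in\mathcal{D}'$ and each fixed $z\in\mathbb{C}\setminus\{t_1^0,\dots,t_{2n}^0\}$, $R(z,\boldsymbol{t})$ is holomorphic in $\boldsymbol{t}$ in a neighborhood of $\boldsymbol{t}^0$; and $R(\infty,\boldsymbol{t})\equiv I$. *)

theory Defs
  imports "HOL-Complex_Analysis.Complex_Analysis"
begin

unbundle no fps_syntax

section \<open>Holomorphic functions of several complex variables\<close>

text \<open>The derivative of the library is real-linear; homogeneity over the complex numbers makes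
  it complex-linear. Only used on open sets \<open>U\<close>.\<close>

definition holo_on :: "(complex ^ 'k \<Rightarrow> complex) \<Rightarrow> (complex ^ 'k) set \<Rightarrow> bool" where
  "holo_on f U \<longleftrightarrow>
     (\<forall>t\<in>U. \<exists>f'. (f has_derivative f') (at t) \<and> (\<forall>c h. f' (c *s h) = c * f' h))"

definition mat_holo_on ::
  "(complex ^ 'k \<Rightarrow> complex ^ 'b ^ 'a) \<Rightarrow> (complex ^ 'k) set \<Rightarrow> bool" where
  "mat_holo_on F U \<longleftrightarrow> (\<forall>i j. holo_on (\<lambda>t. F t $ i $ j) U)"

definition is_domain :: "(complex ^ 'k) set \<Rightarrow> bool" where
  "is_domain D \<longleftrightarrow> open D \<and> connected D \<and> D \<noteq> {}"

section \<open>Pole and zero loci\<close>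

definition diagonal :: "complex ^ 'n ^ 'n \<Rightarrow> bool" where
  "diagonal A \<longleftrightarrow> (\<forall>i j. i \<noteq> j \<longrightarrow> A $ i $ j = 0)"

definition diag_mat :: "('n \<Rightarrow> complex) \<Rightarrow> complex ^ 'n ^ 'n" where
  "diag_mat d = (\<chi> i j. if i = j then d i else 0)"

text \<open>A point of \<open>\<complex>\<^sup>2\<^sup>n\<close> is a vector indexed by \<open>'n + 'n\<close>: the first \<open>n\<close> coordinates
  (the poles) have the indices \<open>Inl k\<close>, the last \<open>n\<close> ones (the zeros) the indices \<open>Inr k\<close>.\<close>

definition C_star :: "(complex ^ ('n::finite + 'n)) set" where
  "C_star = {t. \<forall>k l. k \<noteq> l \<longrightarrow> t $ k \<noteq> t $ l}"

definition A_P :: "complex ^ ('n::finite + 'n) \<Rightarrow> complex ^ 'n ^ 'n" where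
  "A_P t = diag_mat (\<lambda>k. t $ Inl k)"

definition A_Z :: "complex ^ ('n::finite + 'n) \<Rightarrow> complex ^ 'n ^ 'n" where
  "A_Z t = diag_mat (\<lambda>k. t $ Inr k)"

section \<open>Coupling functions and the singular set\<close>

definition coupling ::
  "(complex ^ ('n::finite + 'n) \<Rightarrow> complex ^ 'n ^ 'm) \<Rightarrow> (complex ^ ('n::finite + 'n) \<Rightarrow> complex ^ 'm ^ 'n)
    \<Rightarrow> complex ^ ('n::finite + 'n) \<Rightarrow> complex ^ 'n ^ 'n" where
  "coupling F G t = (THE S. A_Z t ** S - S ** A_P t = G t ** F t)"

definition ZP_admissible ::
  "'a set \<Rightarrow> ('a \<Rightarrow> (complex ^ ('n::finite + 'n)) set)
    \<Rightarrow> ('a \<Rightarrow> complex ^ ('n::finite + 'n) \<Rightarrow> complex ^ 'n ^ 'm)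
    \<Rightarrow> ('a \<Rightarrow> complex ^ ('n::finite + 'n) \<Rightarrow> complex ^ 'm ^ 'n) \<Rightarrow> bool" where
  "ZP_admissible I D F G \<longleftrightarrow> (\<forall>\<alpha>\<in>I. \<exists>t\<in>D \<alpha>. det (coupling (F \<alpha>) (G \<alpha>) t) \<noteq> 0)"

definition ZP_singular_set ::
  "'a set \<Rightarrow> ('a \<Rightarrow> (complex ^ ('n::finite + 'n)) set)
    \<Rightarrow> ('a \<Rightarrow> complex ^ ('n::finite + 'n) \<Rightarrow> complex ^ 'n ^ 'm)
    \<Rightarrow> ('a \<Rightarrow> complex ^ ('n::finite + 'n) \<Rightarrow> complex ^ 'm ^ 'n) \<Rightarrow> (complex ^ ('n::finite + 'n)) set" where
  "ZP_singular_set I D F G = (\<Union>\<alpha>\<in>I. {t \<in> D \<alpha>. det (coupling (F \<alpha>) (G \<alpha>) t) = 0})"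

section \<open>Matrix-valued functions of one complex variable near a point\<close>

text \<open>All notions of this section depend only on the values of the function in a punctured
  neighbourhood of the point. In particular, holomorphy at a point is understood up to a
  removable singularity, so that it applies to the pointwise inverse \<open>\<lambda>z. matrix_inv (R z)\<close>,
  whose value at a pole or zero of \<open>R\<close> is meaningless.\<close>

definition mat_holo_at :: "(complex \<Rightarrow> complex ^ 'b ^ 'a) \<Rightarrow> complex \<Rightarrow> bool" where
  "mat_holo_at R s \<longleftrightarrow>
     (\<forall>i j. \<exists>h. h analytic_on {s} \<and> (\<forall>\<^sub>F z in at s. R z $ i $ j = h z))"

definition mat_holo_at_infinity :: "(complex \<Rightarrow> complex ^ 'b ^ 'a) \<Rightarrow> bool" where
  "mat_holo_at_infinity R \<longleftrightarrow> mat_holo_at (\<lambda>w. R (inverse w)) 0"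

definition mat_simple_pole :: "(complex \<Rightarrow> complex ^ 'm ^ 'm) \<Rightarrow> complex \<Rightarrow> bool" where
  "mat_simple_pole R s \<longleftrightarrow> \<not> mat_holo_at R s \<and> mat_holo_at (\<lambda>z. mat (z - s) ** R z) s"

definition mat_residue :: "(complex \<Rightarrow> complex ^ 'b ^ 'a) \<Rightarrow> complex \<Rightarrow> complex ^ 'b ^ 'a" where
  "mat_residue R s = (\<chi> i j. residue (\<lambda>z. R z $ i $ j) s)"

definition mat_inverse :: "(complex \<Rightarrow> complex ^ 'm ^ 'm) \<Rightarrow> complex \<Rightarrow> complex ^ 'm ^ 'm" where
  "mat_inverse R = (\<lambda>z. matrix_inv (R z))"

definition regular_point :: "(complex \<Rightarrow> complex ^ 'm ^ 'm) \<Rightarrow> complex \<Rightarrow> bool" where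
  "regular_point R s \<longleftrightarrow> mat_holo_at R s \<and> mat_holo_at (mat_inverse R) s"

definition pole_of :: "(complex \<Rightarrow> complex ^ 'm ^ 'm) \<Rightarrow> complex \<Rightarrow> bool" where
  "pole_of R s \<longleftrightarrow> mat_simple_pole R s \<and> mat_holo_at (mat_inverse R) s"

definition zero_of :: "(complex \<Rightarrow> complex ^ 'm ^ 'm) \<Rightarrow> complex \<Rightarrow> bool" where
  "zero_of R s \<longleftrightarrow> mat_simple_pole (mat_inverse R) s \<and> mat_holo_at R s"

section \<open>Generic rational functions\<close>

text \<open>A rational function is represented by the function on \<open>\<complex>\<close> given by its reduced
  fraction, which by \<open>x / 0 = 0\<close> takes the value 0 at the poles. This is a one-to-one
  correspondence: rational functions are equal iff the functions representing them are, and
  the value at every point that is not a pole is the true one.\<close>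

definition rational_fun :: "(complex \<Rightarrow> complex) \<Rightarrow> bool" where
  "rational_fun f \<longleftrightarrow> (\<exists>p q. q \<noteq> 0 \<and> coprime p q \<and> (\<forall>z. f z = poly p z / poly q z))"

definition rational_mat_fun :: "(complex \<Rightarrow> complex ^ 'b ^ 'a) \<Rightarrow> bool" where
  "rational_mat_fun R \<longleftrightarrow> (\<forall>i j. rational_fun (\<lambda>z. R z $ i $ j))"

text \<open>That the determinant does not vanish identically must be tested at a point where \<open>R\<close> is
  holomorphic, because the value at a pole of an entry is conventional.\<close>

definition generic :: "(complex \<Rightarrow> complex ^ 'm ^ 'm) \<Rightarrow> bool" where
  "generic R \<longleftrightarrow>
     rational_mat_fun R \<and>
     (\<exists>z. mat_holo_at R z \<and> det (R z) \<noteq> 0) \<and>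
     (\<forall>s. \<not> regular_point R s \<longrightarrow> pole_of R s \<or> zero_of R s) \<and>
     mat_holo_at_infinity R \<and> mat_holo_at_infinity (mat_inverse R) \<and>
     (\<forall>s. pole_of R s \<longrightarrow> rank (mat_residue R s) = 1) \<and>
     (\<forall>s. zero_of R s \<longrightarrow> rank (mat_residue (mat_inverse R) s) = 1)"

definition has_pole_matrix ::
  "(complex \<Rightarrow> complex ^ 'm ^ 'm) \<Rightarrow> complex ^ 'n ^ 'n \<Rightarrow> bool" where
  "has_pole_matrix R A \<longleftrightarrow> (\<exists>p. bij_betw p UNIV {s. pole_of R s} \<and> A = diag_mat p)"

definition has_zero_matrix ::
  "(complex \<Rightarrow> complex ^ 'm ^ 'm) \<Rightarrow> complex ^ 'n ^ 'n \<Rightarrow> bool" where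
  "has_zero_matrix R A \<longleftrightarrow> (\<exists>p. bij_betw p UNIV {s. zero_of R s} \<and> A = diag_mat p)"

text \<open>In the next two definitions the diagonal of \<open>A\<close>, the pole (zero) matrix of \<open>R\<close>, fixes the
  order of the poles (zeros).\<close>

definition left_pole_semiresidual ::
  "(complex \<Rightarrow> complex ^ 'm ^ 'm) \<Rightarrow> complex ^ 'n ^ 'n \<Rightarrow> complex ^ 'n ^ 'm \<Rightarrow> bool" where
  "left_pole_semiresidual R A F \<longleftrightarrow>
     (\<forall>k. \<exists>g :: complex ^ 'm. mat_residue R (A $ k $ k) = (\<chi> i j. F $ i $ k * g $ j))"

definition right_zero_semiresidual ::
  "(complex \<Rightarrow> complex ^ 'm ^ 'm) \<Rightarrow> complex ^ 'n ^ 'n \<Rightarrow> complex ^ 'm ^ 'n \<Rightarrow> bool" where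
  "right_zero_semiresidual R A G \<longleftrightarrow>
     (\<forall>k. \<exists>f :: complex ^ 'm.
        mat_residue (mat_inverse R) (A $ k $ k) = (\<chi> i j. f $ i * G $ k $ j))"

section \<open>Families\<close>

definition normalized_holomorphic_family ::
  "(complex ^ ('n::finite + 'n)) set \<Rightarrow> (complex ^ ('n::finite + 'n) \<Rightarrow> complex \<Rightarrow> complex ^ 'm ^ 'm) \<Rightarrow> bool" where
  "normalized_holomorphic_family D R \<longleftrightarrow>
     is_domain D \<and> D \<subseteq> C_star \<and>
     (\<forall>t\<in>D. generic (R t) \<and> has_pole_matrix (R t) (A_P t) \<and> has_zero_matrix (R t) (A_Z t)) \<and>
     (\<forall>t0\<in>D. \<forall>z. (\<forall>k. z \<noteq> t0 $ k) \<longrightarrow>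
        (\<exists>U. open U \<and> t0 \<in> U \<and> U \<subseteq> D \<and> mat_holo_on (\<lambda>t. R t z) U)) \<and>
     (\<forall>t\<in>D. (R t \<longlongrightarrow> mat 1) at_infinity)"

text \<open>The defining property of the family: it is normalized holomorphic over \<open>D'\<close>, and over
  \<open>D \<alpha> \<inter> D'\<close> it has the prescribed semiresidual matrices \<open>F \<alpha>\<close> and \<open>G \<alpha>\<close>.\<close>

definition family_with_semiresiduals ::
  "'a set \<Rightarrow> ('a \<Rightarrow> (complex ^ ('n::finite + 'n)) set) \<Rightarrow> (complex ^ ('n::finite + 'n)) set
    \<Rightarrow> ('a \<Rightarrow> complex ^ ('n::finite + 'n) \<Rightarrow> complex ^ 'n ^ 'm)
    \<Rightarrow> ('a \<Rightarrow> complex ^ ('n::finite + 'n) \<Rightarrow> complex ^ 'm ^ 'n)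
    \<Rightarrow> (complex ^ ('n::finite + 'n) \<Rightarrow> complex \<Rightarrow> complex ^ 'm ^ 'm) \<Rightarrow> bool" where
  "family_with_semiresiduals I D D' F G R \<longleftrightarrow>
     normalized_holomorphic_family D' R \<and>
     (\<forall>\<alpha>\<in>I. \<forall>t \<in> D \<alpha> \<inter> D'.
        left_pole_semiresidual (R t) (A_P t) (F \<alpha> t) \<and>
        right_zero_semiresidual (R t) (A_Z t) (G \<alpha> t))"

definition z_derivative :: "(complex \<Rightarrow> complex ^ 'b ^ 'a) \<Rightarrow> complex \<Rightarrow> complex ^ 'b ^ 'a" where
  "z_derivative R z = (\<chi> i j. deriv (\<lambda>w. R w $ i $ j) z)"

end

theory Submission
  imports Defs
begin

text \<open>
  Fix \<open>t\<close> and write \<open>p\<close>, \<open>q\<close> for the poles and zeros, \<open>P = (z - A\<^sub>P)\<^sup>-\<^sup>1\<close>, \<open>Q = (z - A\<^sub>Z)\<^sup>-\<^sup>1\<close>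
  and \<open>T = S\<^sup>-\<^sup>1\<close>. The Lyapunov equation says \<open>G F = S P\<^sup>-\<^sup>1 - Q\<^sup>-\<^sup>1 S\<close> for every \<open>z\<close>, hence
  \<open>P T (G F) T Q = T Q - P T\<close> (\<open>resolvent_coupling\<close>). This one identity gives that
  \<open>I - F P T G\<close> and \<open>I + F T Q G\<close> are inverse to each other (\<open>realization_inverse\<close>) and the
  formula for the logarithmic derivative (\<open>logarithmic_derivative_realization\<close>). Both functions are
  of the form \<open>I + A (z - diag p)\<^sup>-\<^sup>1 B\<close>, whose residue at \<open>p k\<close> is the column \<open>k\<close> of \<open>A\<close> times the
  row \<open>k\<close> of \<open>B\<close>; so the poles, zeros and semiresidual matrices can be read off, once it is known
  that none of these columns and rows vanishes (\<open>coupled_products_nonzero\<close>).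

  Uniqueness (\<open>generic_eq_if_same_semiresiduals\<close>) is a Liouville argument. If two generic
  functions \<open>R1\<close>, \<open>R2\<close> have the same poles, zeros and semiresidual matrices, then
  \<open>R1\<^sup>-\<^sup>1 R2\<close> is entire: at a pole, \<open>R1\<^sup>-\<^sup>1 R1 = I\<close> forces \<open>R1\<^sup>-\<^sup>1\<close> to annihilate the left
  semiresidual column, which is also the column of the residue of \<open>R2\<close>; at a zero, \<open>R2\<close> is annihilated
  from the left by the common right semiresidual row. Since it tends to \<open>I\<close> at infinity,
  Liouville's theorem makes it constant. Uniqueness is also what glues the local formulas: a change
  of chart multiplies \<open>F\<close> and \<open>G\<close> by invertible diagonal matrices, which leaves the semiresidual
  conditions intact, so the functions built in two charts agree.

  That the family lives over a domain is a statement about several complex variables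
  (\<open>is_domain_minus_local_zeros\<close>). In a convex set, the zeros of a holomorphic function on the
  complex line through two non-zeros are countable and so do not disconnect it; hence a ball minus
  the zero set is connected. The singular set has no interior, because by the identity theorem its
  interior is closed relative to the connected domain and admissibility excludes that it is everything.
  These two facts together give the connectedness of the complement.
\<close>

(* The coefficient notation of power series would make every matrix entry ambiguous. *)
no_notation fps_nth (infixl "$" 75)

section \<open>Diagonal matrices and matrix inverses\<close>

lemma diag_mat_nth: "diag_mat d $ i $ j = (if i = j then d i else 0)"
  by (simp add: diag_mat_def)

lemma diag_mat_mult_nth: "(diag_mat d ** A) $ i $ j = d i * A $ i $ j"
  by (simp add: matrix_matrix_mult_def diag_mat_nth if_distrib[of "\<lambda>x. x * _"] cong: if_cong)

lemma mult_diag_mat_nth: "(A ** diag_mat d) $ i $ j = A $ i $ j * d j"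
  by (simp add: matrix_matrix_mult_def diag_mat_nth if_distrib[of "\<lambda>x. _ * x"] cong: if_cong)

lemma matrix_inv_unique:
  fixes A B :: "'a::field ^ 'n ^ 'n"
  assumes "A ** B = mat 1"
  shows "matrix_inv A = B"
proof -
  have "B ** A = mat 1" by (rule matrix_left_right_inverse1[OF assms])
  then have "A ** matrix_inv A = mat 1 \<and> matrix_inv A ** A = mat 1"
    unfolding matrix_inv_def using assms
    by (intro someI[where P = "\<lambda>X. A ** X = mat 1 \<and> X ** A = mat 1" and x = B] conjI)
  then show ?thesis
    by (metis \<open>B ** A = mat 1\<close> matrix_mul_assoc matrix_mul_lid matrix_mul_rid)
qed

lemma matrix_inv_right_det:
  fixes A :: "'a::field ^ 'n ^ 'n"
  assumes "det A \<noteq> 0"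
  shows "A ** matrix_inv A = mat 1"
proof -
  obtain B where "A ** B = mat 1"
    using assms unfolding invertible_det_nz[symmetric] invertible_def by blast
  then show ?thesis using matrix_inv_unique by metis
qed

lemma det_nonzero_if_right_inverse:
  fixes A B :: "'a::field ^ 'n ^ 'n"
  assumes "A ** B = mat 1"
  shows "det A \<noteq> 0"
  using assms matrix_left_right_inverse1[OF assms] unfolding invertible_det_nz[symmetric] invertible_def by blast

text \<open>Expressing the inverse by determinants makes its continuity and holomorphy in parameters a
  matter of polynomials.\<close>

lemma matrix_inv_nth_cramer:
  fixes A :: "'a::field ^ 'n ^ 'n"
  assumes "det A \<noteq> 0"
  shows "matrix_inv A $ i $ j =
    det (\<chi> k l. if l = i then mat 1 $ k $ j else A $ k $ l) / det A"
proof -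
  have "A *v column j (matrix_inv A) = column j (mat 1)"
    unfolding matrix_inv_right_det[OF assms, symmetric]
    by (simp add: vec_eq_iff column_def matrix_vector_mult_def matrix_matrix_mult_def)
  then have "column j (matrix_inv A) =
      (\<chi> k. det (\<chi> i l. if l = k then column j (mat 1) $ i else A $ i $ l) / det A)"
    using cramer[OF assms] by blast
  then have "column j (matrix_inv A) $ i =
      det (\<chi> k l. if l = i then column j (mat 1) $ k else A $ k $ l) / det A"
    by simp
  then show ?thesis unfolding column_def by (simp cong: if_cong)
qed

lemma resolvent_diag:
  assumes "\<And>k. z \<noteq> p k"
  shows "matrix_inv (mat z - diag_mat p) = diag_mat (\<lambda>k. 1 / (z - p k))"
proof (rule matrix_inv_unique)
  have "mat z - diag_mat p = diag_mat (\<lambda>k. z - p k)"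
    by (simp add: vec_eq_iff diag_mat_nth mat_def)
  show "(mat z - diag_mat p) ** diag_mat (\<lambda>k. 1 / (z - p k)) = mat 1"
    unfolding \<open>mat z - diag_mat p = _\<close>
    using assms by (simp add: vec_eq_iff diag_mat_mult_nth diag_mat_nth mat_def)
qed

section \<open>The coupling matrix and the realization formula\<close>

text \<open>With diagonal coefficients the Lyapunov equation decouples into one scalar equation per
  entry, solvable because the two spectra are disjoint.\<close>

lemma lyapunov_diag_iff:
  assumes "\<And>i j. q i \<noteq> p j"
  shows "diag_mat q ** S - S ** diag_mat p = C \<longleftrightarrow> (\<forall>i j. S $ i $ j = C $ i $ j / (q i - p j))"
proof -
  have "(diag_mat q ** S - S ** diag_mat p) $ i $ j = C $ i $ j \<longleftrightarrow>
      S $ i $ j = C $ i $ j / (q i - p j)" for i j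
    using assms[of i j] by (simp add: diag_mat_mult_nth mult_diag_mat_nth eq_divide_eq algebra_simps)
  then show ?thesis by (simp add: vec_eq_iff)
qed

lemma coupling_nth:
  assumes "t \<in> C_star"
  shows "coupling F G t $ i $ j = (G t ** F t) $ i $ j / (t $ Inr i - t $ Inl j)"
proof -
  have ne: "t $ Inr i \<noteq> t $ Inl j" for i j using assms by (auto simp: C_star_def)
  let ?S = "\<chi> i j. (G t ** F t) $ i $ j / (t $ Inr i - t $ Inl j)"
  have "coupling F G t = ?S"
    unfolding coupling_def A_Z_def A_P_def lyapunov_diag_iff[OF ne]
    by (rule the_equality) (auto simp: vec_eq_iff)
  then show ?thesis by simp
qed

lemma coupling_lyapunov:
  assumes "t \<in> C_star"
  shows "A_Z t ** coupling F G t - coupling F G t ** A_P t = G t ** F t"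
proof -
  have ne: "t $ Inr i \<noteq> t $ Inl j" for i j using assms by (auto simp: C_star_def)
  show ?thesis
    unfolding A_Z_def A_P_def lyapunov_diag_iff[OF ne] using coupling_nth[OF assms] by blast
qed

lemma diagonal_imp_diag_mat: "diagonal A \<Longrightarrow> A = diag_mat (\<lambda>k. A $ k $ k)"
  by (auto simp: vec_eq_iff diagonal_def diag_mat_nth)

text \<open>Diagonal factors commute with the pole and zero matrices, so they pass through the
  Lyapunov equation. When they are invertible, \<open>det S\<close> vanishes for both pairs or for neither.\<close>

lemma coupling_rescale:
  assumes "t \<in> C_star" "diagonal E" "diagonal E'" "F' t = F t ** E" "G' t = E' ** G t"
  shows "coupling F' G' t = E' ** coupling F G t ** E"
proof -
  define d e where "d = (\<lambda>k. E $ k $ k)" and "e = (\<lambda>k. E' $ k $ k)"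
  have E: "E = diag_mat d" "E' = diag_mat e"
    using diagonal_imp_diag_mat assms(2,3) unfolding d_def e_def by blast+
  have GF: "G' t ** F' t = E' ** (G t ** F t) ** E"
    by (simp add: assms(4,5) matrix_mul_assoc)
  show ?thesis
    unfolding vec_eq_iff E mult_diag_mat_nth diag_mat_mult_nth coupling_nth[OF assms(1)] GF
    by simp
qed

lemma matrix_diff_ldistrib: "(A::'a::ring_1^'n^'m) ** (B - C) = A ** B - A ** C"
  by (simp add: vec_eq_iff matrix_matrix_mult_def sum_subtractf right_diff_distrib)

lemma matrix_diff_rdistrib: "((A::'a::ring_1^'n^'m) - B) ** C = A ** C - B ** C"
  by (simp add: vec_eq_iff matrix_matrix_mult_def sum_subtractf left_diff_distrib)

lemma matrix_add_rdistrib: "((A::'a::semiring_1^'n^'m) + B) ** C = A ** C + B ** C"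
  by (simp add: vec_eq_iff matrix_matrix_mult_def sum.distrib distrib_right)

lemma matrix_minus_right: "(A::'a::ring_1^'n^'m) ** (- B) = - (A ** B)"
  by (simp add: vec_eq_iff matrix_matrix_mult_def sum_negf)

lemma matrix_minus_left: "(- (A::'a::ring_1^'n^'m)) ** B = - (A ** B)"
  by (simp add: vec_eq_iff matrix_matrix_mult_def sum_negf)

text \<open>The same shape serves \<open>R = I - F P T G\<close> and its inverse \<open>I + F T Q G\<close>. The expression is
  total: at \<open>z = p k\<close> the term with index \<open>k\<close> is dropped, because \<open>1 / 0 = 0\<close>.\<close>

definition realization ::
  "('n::finite \<Rightarrow> complex) \<Rightarrow> complex ^ 'n ^ 'm \<Rightarrow> complex ^ 'm ^ 'n \<Rightarrow> complex \<Rightarrow> complex ^ 'm ^ 'm" where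
  "realization p A B z = mat 1 + A ** diag_mat (\<lambda>k. 1 / (z - p k)) ** B"

lemma diag_mat_sandwich_nth:
  "(A ** diag_mat d ** B) $ i $ j = (\<Sum>k\<in>UNIV. A $ i $ k * d k * B $ k $ j)"
proof -
  have "(A ** diag_mat d ** B) $ i $ j = (\<Sum>k\<in>UNIV. (A ** diag_mat d) $ i $ k * B $ k $ j)"
    by (simp add: matrix_matrix_mult_def)
  then show ?thesis unfolding mult_diag_mat_nth .
qed

lemma realization_nth:
  "realization p A B z $ i $ j = mat 1 $ i $ j + (\<Sum>k\<in>UNIV. A $ i $ k * B $ k $ j / (z - p k))"
  by (simp add: realization_def diag_mat_sandwich_nth)

text \<open>Substitute \<open>G F = S P\<^sup>-\<^sup>1 - Q\<^sup>-\<^sup>1 S\<close>, which is the Lyapunov equation with \<open>z S\<close> added and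
  subtracted.\<close>

lemma resolvent_coupling:
  fixes S T :: "complex ^ 'n ^ 'n"
  assumes lyap: "diag_mat q ** S - S ** diag_mat p = G ** F"
    and T: "S ** T = mat 1"
    and z: "\<And>k. z \<noteq> p k" "\<And>k. z \<noteq> q k"
  defines "P \<equiv> diag_mat (\<lambda>k. 1 / (z - p k))" and "Q \<equiv> diag_mat (\<lambda>k. 1 / (z - q k))"
  shows "P ** T ** G ** F ** T ** Q = T ** Q - P ** T"
proof -
  have TS: "T ** S = mat 1" by (rule matrix_left_right_inverse1[OF T])
  define P' Q' where "P' = diag_mat (\<lambda>k. z - p k)" and "Q' = diag_mat (\<lambda>k. z - q k)"
  have PP: "P ** P' = mat 1" "Q' ** Q = mat 1"
    using z by (simp_all add: P_def P'_def Q_def Q'_def vec_eq_iff diag_mat_mult_nth diag_mat_nth mat_def)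
  have GF: "G ** F = S ** P' - Q' ** S"
    unfolding lyap[symmetric]
    by (simp add: vec_eq_iff P'_def Q'_def diag_mat_mult_nth mult_diag_mat_nth algebra_simps)
  have "P ** T ** G ** F ** T ** Q = P ** T ** (G ** F) ** T ** Q"
    by (simp add: matrix_mul_assoc)
  also have "\<dots> = P ** (T ** S) ** P' ** T ** Q - P ** T ** Q' ** (S ** T) ** Q"
    unfolding GF by (simp add: matrix_mul_assoc matrix_diff_ldistrib matrix_diff_rdistrib matrix_minus_left matrix_minus_right)
  also have "\<dots> = (P ** P') ** T ** Q - P ** T ** (Q' ** Q)"
    by (simp add: T TS matrix_mul_assoc)
  finally show ?thesis by (simp add: PP)
qed

text \<open>Expanding the product, the quadratic term is \<open>F\<close> times the left side of
  \<open>resolvent_coupling\<close> times \<open>G\<close>, and cancels the two linear terms.\<close>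

lemma realization_inverse:
  fixes S T :: "complex ^ 'n ^ 'n"
  assumes "diag_mat q ** S - S ** diag_mat p = G ** F" and "S ** T = mat 1"
    and "\<And>k. z \<noteq> p k" "\<And>k. z \<noteq> q k"
  shows "realization p F (- (T ** G)) z ** realization q (F ** T) G z = mat 1"
proof -
  define P Q where "P = diag_mat (\<lambda>k. 1 / (z - p k))" and "Q = diag_mat (\<lambda>k. 1 / (z - q k))"
  have "P ** T ** G ** F ** T ** Q = T ** Q - P ** T"
    unfolding P_def Q_def by (rule resolvent_coupling[OF assms])
  then have "F ** (P ** T ** G ** F ** T ** Q) ** G = F ** (T ** Q - P ** T) ** G"
    by simp
  then show ?thesis
    unfolding realization_def P_def[symmetric] Q_def[symmetric]
    by (simp add: matrix_add_ldistrib matrix_add_rdistrib matrix_mul_assoc matrix_diff_ldistrib matrix_diff_rdistrib matrix_minus_left matrix_minus_right)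
qed

section \<open>Matrix-valued functions near a point\<close>

text \<open>Unlike \<open>mat_holo_at\<close>, this includes the value at the point itself, so residues can be
  obtained by evaluation.\<close>

definition mat_analytic_at :: "(complex \<Rightarrow> complex ^ 'b ^ 'a) \<Rightarrow> complex \<Rightarrow> bool" where
  "mat_analytic_at M s \<longleftrightarrow> (\<forall>i j. (\<lambda>z. M z $ i $ j) analytic_on {s})"

text \<open>The finitely many entrywise extensions can be assembled into one analytic matrix function.\<close>

lemma mat_holo_at_iff:
  fixes R :: "complex \<Rightarrow> complex ^ 'b::finite ^ 'a::finite"
  shows "mat_holo_at R s \<longleftrightarrow> (\<exists>M. mat_analytic_at M s \<and> (\<forall>\<^sub>F z in at s. R z = M z))"
proof
  assume "mat_holo_at R s"
  then obtain h where h: "\<And>i j. h i j analytic_on {s}" "\<And>i j. \<forall>\<^sub>F z in at s. R z $ i $ j = h i j z"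
    unfolding mat_holo_at_def by metis
  define M where "M = (\<lambda>z. (\<chi> i j. h i j z) :: complex ^ 'b ^ 'a)"
  have "\<forall>\<^sub>F z in at s. \<forall>i j. R z $ i $ j = h i j z"
    using h(2) by (simp add: eventually_all_finite)
  then have "\<forall>\<^sub>F z in at s. R z = M z"
    by eventually_elim (simp add: M_def vec_eq_iff)
  moreover have "mat_analytic_at M s"
    using h(1) by (simp add: mat_analytic_at_def M_def)
  ultimately show "\<exists>M. mat_analytic_at M s \<and> (\<forall>\<^sub>F z in at s. R z = M z)" by blast
next
  assume "\<exists>M. mat_analytic_at M s \<and> (\<forall>\<^sub>F z in at s. R z = M z)"
  then obtain M where M: "mat_analytic_at M s" "\<forall>\<^sub>F z in at s. R z = M z" by blast
  have "\<forall>\<^sub>F z in at s. R z $ i $ j = M z $ i $ j" for i j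
    using M(2) by eventually_elim simp
  with M(1) show "mat_holo_at R s"
    unfolding mat_holo_at_def mat_analytic_at_def by blast
qed

lemma mat_holo_atI:
  fixes M :: "complex \<Rightarrow> complex ^ 'b::finite ^ 'a::finite"
  shows "mat_analytic_at M s \<Longrightarrow> mat_holo_at M s"
  unfolding mat_holo_at_iff by auto

lemma mat_holo_at_cong:
  assumes "\<forall>\<^sub>F z in at s. R z = T z" "mat_holo_at T s"
  shows "mat_holo_at R s"
  unfolding mat_holo_at_def
proof (intro allI)
  fix i j
  obtain h where "h analytic_on {s}" and h: "\<forall>\<^sub>F z in at s. T z $ i $ j = h z"
    using assms(2) unfolding mat_holo_at_def by blast
  moreover have "\<forall>\<^sub>F z in at s. R z $ i $ j = h z"
    using assms(1) h by eventually_elim simp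
  ultimately show "\<exists>h. h analytic_on {s} \<and> (\<forall>\<^sub>F z in at s. R z $ i $ j = h z)" by blast
qed

lemma mat_analytic_at_mult:
  "mat_analytic_at M s \<Longrightarrow> mat_analytic_at N s \<Longrightarrow> mat_analytic_at (\<lambda>z. M z ** N z) s"
  unfolding mat_analytic_at_def matrix_matrix_mult_def
  by (auto intro!: analytic_on_sum analytic_on_mult)

lemma mat_holo_at_mult:
  fixes R :: "complex \<Rightarrow> complex ^ 'b::finite ^ 'a::finite"
  assumes "mat_holo_at R s" "mat_holo_at T s"
  shows "mat_holo_at (\<lambda>z. R z ** T z) s"
proof -
  obtain M N where M: "mat_analytic_at M s" "\<forall>\<^sub>F z in at s. R z = M z"
    and N: "mat_analytic_at N s" "\<forall>\<^sub>F z in at s. T z = N z"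
    using assms unfolding mat_holo_at_iff by blast
  have "\<forall>\<^sub>F z in at s. R z ** T z = M z ** N z"
    using M(2) N(2) by eventually_elim simp
  then show ?thesis
    using mat_analytic_at_mult[OF M(1) N(1)] unfolding mat_holo_at_iff by blast
qed

lemma analytic_eq_at_limit:
  fixes h k :: "complex \<Rightarrow> complex"
  assumes "h analytic_on {s}" "k analytic_on {s}" "\<forall>\<^sub>F z in at s. h z = k z"
  shows "h s = k s"
proof -
  have "h \<midarrow>s\<rightarrow> h s" "k \<midarrow>s\<rightarrow> k s"
    using assms(1,2)[THEN analytic_at_imp_isCont] by (simp_all add: isCont_def)
  from this(1) assms(3) have "k \<midarrow>s\<rightarrow> h s" by (rule Lim_transform_eventually)
  then show ?thesis using \<open>k \<midarrow>s\<rightarrow> k s\<close> by (rule LIM_unique)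
qed

lemma mat_analytic_eq_at_limit:
  assumes "mat_analytic_at M s" "mat_analytic_at N s" "\<forall>\<^sub>F z in at s. M z = N z"
  shows "M s = N s"
proof -
  have "M s $ i $ j = N s $ i $ j" for i j
  proof (rule analytic_eq_at_limit[of "\<lambda>z. M z $ i $ j" s "\<lambda>z. N z $ i $ j"])
    show "\<forall>\<^sub>F z in at s. M z $ i $ j = N z $ i $ j"
      using assms(3) by eventually_elim simp
  qed (use assms(1,2) in \<open>auto simp: mat_analytic_at_def\<close>)
  then show ?thesis by (simp add: vec_eq_iff)
qed

lemma analytic_divide_linear:
  assumes "h analytic_on {s}" "h s = 0"
  shows "\<exists>g. g analytic_on {s} \<and> (\<forall>\<^sub>F z in at s. h z / (z - s) = g z)"
proof -
  let ?f = "\<lambda>z. h z / (z - s)"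
  let ?g = "\<lambda>z. if z = s then deriv h s else ?f z - h s / (z - s)"
  have "?g analytic_on {s}"
  proof (rule pole_theorem_analytic[OF assms(1)])
    show "\<exists>d>0. \<forall>w\<in>ball z d - {s}. h w = (w - s) * ?f w" for z
      by (rule exI[of _ 1]) auto
  qed
  moreover have "\<forall>\<^sub>F z in at s. ?f z = ?g z"
    using assms(2) by (auto simp: eventually_at_filter)
  ultimately show ?thesis by blast
qed

lemma mat_scalar_mult_nth: "(mat c ** A) $ i $ j = c * A $ i $ j"
  by (simp add: matrix_matrix_mult_def mat_def if_distrib[of "\<lambda>x. x * _"] cong: if_cong)

text \<open>The function \<open>M\<close> is the analytic extension of \<open>(z - s) R z\<close>; when it vanishes at \<open>s\<close>, the
  factor \<open>z - s\<close> can be divided out.\<close>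

lemma removable_if_residue_zero:
  fixes R :: "complex \<Rightarrow> complex ^ 'm::finite ^ 'm"
  assumes "mat_analytic_at M s" "M s = 0" "\<forall>\<^sub>F z in at s. M z = mat (z - s) ** R z"
  shows "mat_holo_at R s"
  unfolding mat_holo_at_def
proof (intro allI)
  fix i j
  obtain g where "g analytic_on {s}" and g: "\<forall>\<^sub>F z in at s. M z $ i $ j / (z - s) = g z"
    using analytic_divide_linear[of "\<lambda>z. M z $ i $ j" s] assms(1,2)
    by (auto simp: mat_analytic_at_def)
  moreover have "\<forall>\<^sub>F z in at s. z \<noteq> s" by (simp add: eventually_at_filter)
  then have "\<forall>\<^sub>F z in at s. R z $ i $ j = g z"
    using g assms(3) by eventually_elim (auto simp: mat_scalar_mult_nth)
  ultimately show "\<exists>h. h analytic_on {s} \<and> (\<forall>\<^sub>F z in at s. R z $ i $ j = h z)" by blast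
qed

lemma mat_residue_eq:
  fixes R :: "complex \<Rightarrow> complex ^ 'm::finite ^ 'm"
  assumes "mat_analytic_at M s" "\<forall>\<^sub>F z in at s. M z = mat (z - s) ** R z"
  shows "mat_residue R s = M s"
proof -
  have "residue (\<lambda>z. R z $ i $ j) s = M s $ i $ j" for i j
  proof -
    have "\<forall>\<^sub>F z in at s. z \<noteq> s" by (simp add: eventually_at_filter)
    then have "\<forall>\<^sub>F z in at s. R z $ i $ j = M z $ i $ j / (z - s)"
      using assms(2) by eventually_elim (simp add: mat_scalar_mult_nth)
    then have "residue (\<lambda>z. R z $ i $ j) s = residue (\<lambda>z. M z $ i $ j / (z - s)) s"
      by (intro residue_cong) auto
    also obtain U where "open U" "s \<in> U" "(\<lambda>z. M z $ i $ j) holomorphic_on U"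
      using assms(1) unfolding mat_analytic_at_def analytic_at by blast
    then have "residue (\<lambda>z. M z $ i $ j / (z - s)) s = M s $ i $ j"
      by (rule residue_simple)
    finally show ?thesis .
  qed
  then show ?thesis by (simp add: mat_residue_def vec_eq_iff)
qed

lemma mat_analytic_at_scalar_mult:
  fixes N :: "complex \<Rightarrow> complex ^ 'b ^ 'm::finite"
  shows "mat_analytic_at N s \<Longrightarrow> mat_analytic_at (\<lambda>z. mat (z - s) ** N z) s"
  unfolding mat_analytic_at_def mat_scalar_mult_nth
  by (auto intro!: analytic_intros)

lemma mat_simple_poleI:
  fixes R :: "complex \<Rightarrow> complex ^ 'm::finite ^ 'm"
  assumes "mat_analytic_at M s" "\<forall>\<^sub>F z in at s. M z = mat (z - s) ** R z" "M s \<noteq> 0"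
  shows "mat_simple_pole R s"
  unfolding mat_simple_pole_def
proof
  show "mat_holo_at (\<lambda>z. mat (z - s) ** R z) s"
    using assms(2) by (intro mat_holo_at_cong[OF _ mat_holo_atI[OF assms(1)]]) (simp add: eq_commute)
  show "\<not> mat_holo_at R s"
  proof
    assume "mat_holo_at R s"
    then obtain N where N: "mat_analytic_at N s" "\<forall>\<^sub>F z in at s. R z = N z"
      unfolding mat_holo_at_iff by blast
    have "\<forall>\<^sub>F z in at s. M z = mat (z - s) ** N z"
      using assms(2) N(2) by eventually_elim simp
    then have "M s = mat (s - s) ** N s"
      using mat_analytic_eq_at_limit[OF assms(1) mat_analytic_at_scalar_mult[OF N(1)]] by simp
    then show False using assms(3) by (simp add: vec_eq_iff mat_scalar_mult_nth)
  qed
qed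

text \<open>The residue of a simple pole is nonzero, as otherwise the singularity would be removable.\<close>

lemma mat_simple_poleE:
  fixes R :: "complex \<Rightarrow> complex ^ 'm::finite ^ 'm"
  assumes "mat_simple_pole R s"
  obtains M where "mat_analytic_at M s" "\<forall>\<^sub>F z in at s. M z = mat (z - s) ** R z"
    "M s = mat_residue R s" "M s \<noteq> 0"
proof -
  obtain M where M: "mat_analytic_at M s" "\<forall>\<^sub>F z in at s. mat (z - s) ** R z = M z"
    using assms unfolding mat_simple_pole_def mat_holo_at_iff by blast
  then have M2: "\<forall>\<^sub>F z in at s. M z = mat (z - s) ** R z" by (simp add: eq_commute)
  have "M s \<noteq> 0"
    using removable_if_residue_zero[OF M(1) _ M2] assms unfolding mat_simple_pole_def by blast
  then show thesis by (rule that[OF M(1) M2 mat_residue_eq[OF M(1) M2, symmetric]])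
qed

lemma rank_outer_product:
  fixes u :: "complex ^ 'm" and v :: "complex ^ 'n"
  assumes "u \<noteq> 0" "v \<noteq> 0"
  shows "rank (\<chi> i j. u $ i * v $ j :: complex ^ 'n ^ 'm) = 1"
proof -
  let ?A = "\<chi> i j. u $ i * v $ j :: complex ^ 'n ^ 'm"
  have rows: "rows ?A = range (\<lambda>i. u $ i *s v)"
    by (auto simp: rows_def row_def vec_eq_iff image_iff)
  obtain i where i: "u $ i \<noteq> 0" using assms(1) by (auto simp: vec_eq_iff)
  have "vec.dim (rows ?A) = card {u $ i *s v}"
  proof (rule vec.dim_unique[OF _ _ _ refl])
    show "{u $ i *s v} \<subseteq> rows ?A" by (auto simp: rows)
    show "vec.independent {u $ i *s v}" using i assms(2) by simp
    have "u $ k *s v \<in> vec.span {u $ i *s v}" for k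
    proof -
      have "u $ k *s v = (u $ k / u $ i) *s (u $ i *s v)" using i by simp
      then show ?thesis by (metis vec.span_base vec.span_scale singletonI)
    qed
    then show "rows ?A \<subseteq> vec.span {u $ i *s v}" by (auto simp: rows)
  qed
  then show ?thesis by (simp add: row_rank_def_gen)
qed

section \<open>Rational functions\<close>

lemma eventually_poly_nonzero:
  fixes q :: "complex poly"
  assumes "q \<noteq> 0"
  shows "\<forall>\<^sub>F z in at s. poly q z \<noteq> 0"
proof -
  have "open (- ({z. poly q z = 0} - {s}))"
    using poly_roots_finite[OF assms] by (intro open_Compl finite_imp_closed finite_Diff)
  then show ?thesis
    unfolding eventually_at_topological by (intro exI[of _ "- ({z. poly q z = 0} - {s})"]) auto
qed

lemma coprime_poly_no_common_root:
  fixes p q :: "complex poly"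
  assumes "coprime p q" "poly q z = 0"
  shows "poly p z \<noteq> 0"
  using assms coprime_poly_0 by blast

text \<open>Cross-multiplied, the two fractions give the same polynomial. As both are reduced, their
  denominators have the same roots, so that the conventional value 0 is taken at the same points.\<close>

lemma rational_fun_eqI:
  assumes "rational_fun f" "rational_fun g" "\<forall>\<^sub>F z in at s. f z = g z"
  shows "f = g"
proof -
  obtain p1 q1 where f: "q1 \<noteq> 0" "coprime p1 q1" "\<And>z. f z = poly p1 z / poly q1 z"
    using assms(1) unfolding rational_fun_def by blast
  obtain p2 q2 where g: "q2 \<noteq> 0" "coprime p2 q2" "\<And>z. g z = poly p2 z / poly q2 z"
    using assms(2) unfolding rational_fun_def by blast
  have "\<forall>\<^sub>F z in at s. poly (p1 * q2 - p2 * q1) z = 0"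
    using assms(3) eventually_poly_nonzero[OF f(1)] eventually_poly_nonzero[OF g(1)]
    by eventually_elim (simp add: f(3) g(3) field_simps)
  have "p1 * q2 - p2 * q1 = 0"
  proof (rule ccontr)
    assume "p1 * q2 - p2 * q1 \<noteq> 0"
    then have "\<forall>\<^sub>F z in at s. poly (p1 * q2 - p2 * q1) z \<noteq> 0"
      by (rule eventually_poly_nonzero)
    with \<open>\<forall>\<^sub>F z in at s. poly (p1 * q2 - p2 * q1) z = 0\<close> have "\<forall>\<^sub>F z in at s. False"
      by eventually_elim simp
    then show False by simp
  qed
  then have eq: "poly p1 z * poly q2 z = poly p2 z * poly q1 z" for z
    by (metis eq_iff_diff_eq_0 poly_mult)
  show ?thesis
  proof
    fix z
    have "poly q1 z = 0 \<longleftrightarrow> poly q2 z = 0"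
      using eq[of z] coprime_poly_no_common_root[OF f(2), of z] coprime_poly_no_common_root[OF g(2), of z]
      by auto
    then show "f z = g z" using eq[of z] by (auto simp: f(3) g(3) field_simps)
  qed
qed

text \<open>Rationality without reduced fractions: in contrast to \<open>rational_fun\<close>, this is closed under
  sums and products, at the price of a set \<open>X\<close> on which the denominators must not vanish.\<close>

definition rational_on :: "complex set \<Rightarrow> (complex \<Rightarrow> complex) \<Rightarrow> bool" where
  "rational_on X f \<longleftrightarrow> (\<exists>p q. \<forall>z\<in>X. poly q z \<noteq> 0 \<and> f z = poly p z / poly q z)"

lemma rational_on_const: "rational_on X (\<lambda>_. c)"
  unfolding rational_on_def by (intro exI[of _ "[:c:]"] exI[of _ 1]) simp

lemma rational_on_simple_fraction: "a \<notin> X \<Longrightarrow> rational_on X (\<lambda>z. c / (z - a))"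
  unfolding rational_on_def by (intro exI[of _ "[:c:]"] exI[of _ "[:-a, 1:]"]) auto

lemma rational_on_add:
  assumes "rational_on X f" "rational_on X g"
  shows "rational_on X (\<lambda>z. f z + g z)"
proof -
  obtain p1 q1 p2 q2 where
    "\<forall>z\<in>X. poly q1 z \<noteq> 0 \<and> f z = poly p1 z / poly q1 z" "\<forall>z\<in>X. poly q2 z \<noteq> 0 \<and> g z = poly p2 z / poly q2 z"
    using assms unfolding rational_on_def by blast
  then show ?thesis unfolding rational_on_def
    by (intro exI[of _ "p1 * q2 + p2 * q1"] exI[of _ "q1 * q2"]) (auto simp: field_simps)
qed

lemma rational_on_mult:
  assumes "rational_on X f" "rational_on X g"
  shows "rational_on X (\<lambda>z. f z * g z)"
proof -
  obtain p1 q1 p2 q2 where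
    "\<forall>z\<in>X. poly q1 z \<noteq> 0 \<and> f z = poly p1 z / poly q1 z" "\<forall>z\<in>X. poly q2 z \<noteq> 0 \<and> g z = poly p2 z / poly q2 z"
    using assms unfolding rational_on_def by blast
  then show ?thesis unfolding rational_on_def
    by (intro exI[of _ "p1 * p2"] exI[of _ "q1 * q2"]) auto
qed

lemma rational_on_sum:
  "(\<And>k. k \<in> K \<Longrightarrow> rational_on X (f k)) \<Longrightarrow> rational_on X (\<lambda>z. \<Sum>k\<in>K. f k z)"
  by (induction K rule: infinite_finite_induct) (auto intro: rational_on_const rational_on_add)

lemma rational_on_prod:
  "(\<And>k. k \<in> K \<Longrightarrow> rational_on X (f k)) \<Longrightarrow> rational_on X (\<lambda>z. \<Prod>k\<in>K. f k z)"
  by (induction K rule: infinite_finite_induct) (auto intro: rational_on_const rational_on_mult)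

lemma rational_on_det:
  "(\<And>i j. rational_on X (\<lambda>z. R z $ i $ j)) \<Longrightarrow> rational_on X (\<lambda>z. det (R z))"
  unfolding det_def by (intro rational_on_sum rational_on_mult rational_on_const rational_on_prod)

text \<open>A representing fraction with a denominator of least degree is reduced.\<close>

lemma rational_on_imp_rational_fun:
  assumes "rational_on X f" "X \<noteq> {}"
  shows "\<exists>g. rational_fun g \<and> (\<forall>z\<in>X. g z = f z)"
proof -
  define represents where "represents p q \<longleftrightarrow> (\<forall>z\<in>X. poly q z \<noteq> 0 \<and> f z = poly p z / poly q z)" for p q
  have ex: "\<exists>n p q. represents p q \<and> degree q = n"
    using assms(1) unfolding rational_on_def represents_def by auto
  obtain p q where pq: "represents p q"
    and least: "degree q = (LEAST n. \<exists>p q. represents p q \<and> degree q = n)"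
    using LeastI_ex[OF ex] by blast
  have minimal: "degree q \<le> degree q'" if "represents p' q'" for p' q'
    unfolding least using that by (intro Least_le) blast
  have "q \<noteq> 0" using pq assms(2) unfolding represents_def by auto
  have "coprime p q"
  proof (rule ccontr)
    assume "\<not> coprime p q"
    then obtain d where d: "d dvd p" "d dvd q" "\<not> is_unit d" by (rule not_coprimeE)
    then obtain p' q' where pq': "p = d * p'" "q = d * q'" by (auto elim!: dvdE)
    then have "d \<noteq> 0" "q' \<noteq> 0" using \<open>q \<noteq> 0\<close> by auto
    then have "degree q' < degree q"
      using d(3) pq'(2) by (simp add: degree_mult_eq is_unit_iff_degree)
    moreover have "represents p' q'"
      using pq unfolding represents_def pq' by auto
    ultimately show False using minimal by fastforce
  qed
  then have "rational_fun (\<lambda>z. poly p z / poly q z)"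
    using \<open>q \<noteq> 0\<close> unfolding rational_fun_def by blast
  then show ?thesis
    using pq unfolding represents_def by (intro exI[of _ "\<lambda>z. poly p z / poly q z"]) auto
qed

text \<open>At a root of the denominator the numerator would also vanish, by continuity of
  \<open>p = q h\<close>.\<close>

lemma denominator_nonzero_if_holomorphic:
  assumes "coprime p q" "q \<noteq> 0" "\<And>z. f z = poly p z / poly q z"
    and "h analytic_on {s}" "\<forall>\<^sub>F z in at s. f z = h z"
  shows "poly q s \<noteq> 0"
proof
  assume "poly q s = 0"
  have "\<forall>\<^sub>F z in at s. poly p z = poly q z * h z"
    using assms(5) eventually_poly_nonzero[OF assms(2)]
    by eventually_elim (auto simp: assms(3) field_simps)
  moreover have poly: "poly r analytic_on {s}" for r
    unfolding analytic_at by (intro exI[of _ UNIV]) (auto intro!: poly_holomorphic_on)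
  moreover have "(\<lambda>z. poly q z * h z) analytic_on {s}"
    by (intro analytic_on_mult poly assms(4))
  ultimately have "poly p s = poly q s * h s"
    using analytic_eq_at_limit by blast
  then show False
    using coprime_poly_no_common_root[OF assms(1) \<open>poly q s = 0\<close>] \<open>poly q s = 0\<close> by simp
qed

text \<open>The determinant is a quotient of polynomials away from the poles of the entries, and its
  numerator is not the zero polynomial. This is what makes the pointwise inverse of a generic
  function a true inverse near every point, also near its singularities.\<close>

lemma generic_eventually_det_nonzero:
  fixes R :: "complex \<Rightarrow> complex ^ 'm::finite ^ 'm"
  assumes "generic R"
  shows "\<forall>\<^sub>F z in at s. det (R z) \<noteq> 0"
proof -
  have "\<forall>i j. \<exists>p q. q \<noteq> 0 \<and> coprime p q \<and> (\<forall>z. R z $ i $ j = poly p z / poly q z)"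
    using assms unfolding generic_def rational_mat_fun_def rational_fun_def by blast
  then obtain p q where pq: "\<And>i j. q i j \<noteq> 0" "\<And>i j. coprime (p i j) (q i j)"
    "\<And>i j z. R z $ i $ j = poly (p i j) z / poly (q i j) z"
    by metis
  define X where "X = {z. \<forall>i j. poly (q i j) z \<noteq> 0}"
  have "rational_on X (\<lambda>z. R z $ i $ j)" for i j
    unfolding rational_on_def X_def
    by (intro exI[of _ "p i j"] exI[of _ "q i j"]) (auto simp: pq(3))
  then have "rational_on X (\<lambda>z. det (R z))" by (rule rational_on_det)
  then obtain P Q where PQ: "\<And>z. z \<in> X \<Longrightarrow> poly Q z \<noteq> 0 \<and> det (R z) = poly P z / poly Q z"
    unfolding rational_on_def by blast
  obtain z0 where z0: "mat_holo_at R z0" "det (R z0) \<noteq> 0"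
    using assms unfolding generic_def by blast
  have "poly (q i j) z0 \<noteq> 0" for i j
  proof -
    obtain h where "h analytic_on {z0}" "\<forall>\<^sub>F z in at z0. R z $ i $ j = h z"
      using z0(1) unfolding mat_holo_at_def by blast
    then show ?thesis
      using denominator_nonzero_if_holomorphic[OF pq(2) pq(1), of "\<lambda>z. R z $ i $ j" i j h z0] pq(3) by blast
  qed
  then have "z0 \<in> X" by (simp add: X_def)
  then have "P \<noteq> 0" using PQ z0(2) by force
  have "\<forall>\<^sub>F z in at s. \<forall>i j. poly (q i j) z \<noteq> 0"
    using eventually_poly_nonzero pq(1) by (simp add: eventually_all_finite)
  then show ?thesis
    using eventually_poly_nonzero[OF \<open>P \<noteq> 0\<close>, of s]
    by eventually_elim (use PQ in \<open>auto simp: X_def\<close>)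
qed

section \<open>Liouville's theorem and limits at infinity\<close>

text \<open>The limits of \<open>f\<close> define an entire function with the same limit at infinity.\<close>

lemma Liouville_removable:
  fixes f :: "complex \<Rightarrow> complex"
  assumes loc: "\<And>s. \<exists>h. h analytic_on {s} \<and> (\<forall>\<^sub>F z in at s. f z = h z)"
    and lim: "(f \<longlongrightarrow> L) at_infinity"
  shows "\<forall>\<^sub>F z in at s. f z = L"
proof -
  obtain h where h: "\<And>s. h s analytic_on {s}" "\<And>s. \<forall>\<^sub>F z in at s. f z = h s z"
    using loc by metis
  define g where "g s = h s s" for s
  have lim_f: "f \<midarrow>s\<rightarrow> g s" for s
  proof -
    have "h s \<midarrow>s\<rightarrow> g s"
      using analytic_at_imp_isCont[OF h(1)[of s]] by (simp add: isCont_def g_def)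
    then show ?thesis
      by (rule Lim_transform_eventually) (use h(2)[of s] in \<open>simp add: eq_commute\<close>)
  qed
  have eq: "\<forall>\<^sub>F z in nhds s. g z = h s z" for s
  proof -
    obtain U where U: "open U" "s \<in> U" "h s holomorphic_on U"
      using h(1)[of s] unfolding analytic_at by blast
    obtain V where V: "open V" "s \<in> V" "\<And>z. z \<in> V \<Longrightarrow> z \<noteq> s \<Longrightarrow> f z = h s z"
      using h(2)[of s] unfolding eventually_at_topological by blast
    have "g z = h s z" if z: "z \<in> U \<inter> V" for z
    proof (cases "z = s")
      case False
      have "\<forall>\<^sub>F w in at z. w \<in> V - {s}"
        using V(1) z False by (intro eventually_at_in_open') (auto intro: open_delete)
      then have eq: "\<forall>\<^sub>F w in at z. h s w = f w"
        by eventually_elim (use V(3) in auto)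
      have "continuous_on U (h s)" using U(3) by (rule holomorphic_on_imp_continuous_on)
      then have "isCont (h s) z" using U(1) z by (simp add: continuous_on_eq_continuous_at)
      then have "h s \<midarrow>z\<rightarrow> h s z" by (simp add: isCont_def)
      then have "f \<midarrow>z\<rightarrow> h s z" using eq by (rule Lim_transform_eventually)
      then show ?thesis using lim_f[of z] by (rule LIM_unique[symmetric])
    qed (simp add: g_def)
    then show ?thesis
      using U V unfolding eventually_nhds by (intro exI[of _ "U \<inter> V"]) auto
  qed
  have "g analytic_on {s}" for s
    using h(1)[of s] analytic_at_cong[OF eq refl] by blast
  then have "g holomorphic_on UNIV"
    by (metis UNIV_I analytic_imp_holomorphic analytic_on_analytic_at)
  moreover have "(g \<longlongrightarrow> L) at_infinity"
  proof (rule tendstoI)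
    fix e :: real assume "e > 0"
    then have "\<forall>\<^sub>F z in at_infinity. dist (f z) L < e / 2"
      using tendstoD[OF lim, of "e / 2"] by simp
    then obtain b where b: "\<And>z. b \<le> norm z \<Longrightarrow> dist (f z) L < e / 2"
      unfolding eventually_at_infinity by blast
    \<comment> \<open>\<open>g\<close> and \<open>f\<close> may differ at infinitely many points, so the bound on \<open>f\<close> is carried over by a limit at \<open>z\<close>.\<close>
    have "dist (g z) L < e" if "norm z > b" for z
    proof -
      have "open {w. norm w > b}" by (intro open_Collect_less continuous_intros)
      then have "\<forall>\<^sub>F w in at z. w \<in> {w. norm w > b}"
        using that by (intro eventually_at_in_open') auto
      then have bound: "\<forall>\<^sub>F w in at z. dist (f w) L \<le> e / 2"
        by eventually_elim (use b in \<open>fastforce intro: less_imp_le\<close>)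
      have "((\<lambda>w. dist (f w) L) \<longlongrightarrow> dist (g z) L) (at z)"
        by (intro tendsto_dist lim_f tendsto_const)
      then have "dist (g z) L \<le> e / 2"
        using bound by (rule tendsto_upperbound) simp
      then show ?thesis using \<open>e > 0\<close> by linarith
    qed
    then show "\<forall>\<^sub>F z in at_infinity. dist (g z) L < e"
      unfolding eventually_at_infinity by (intro exI[of _ "b + 1"]) auto
  qed
  ultimately have g: "g z = L" for z by (rule Liouville_weak)
  have "\<forall>\<^sub>F z in at s. g z = h s z"
    using eq[of s] unfolding eventually_nhds_conv_at by blast
  then show ?thesis using h(2)[of s] by eventually_elim (use g in auto)
qed

lemma tendsto_det:
  fixes R :: "complex \<Rightarrow> complex ^ 'm::finite ^ 'm"
  assumes "\<And>i j. ((\<lambda>z. R z $ i $ j) \<longlongrightarrow> A $ i $ j) net"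
  shows "((\<lambda>z. det (R z)) \<longlongrightarrow> det A) net"
  unfolding det_def by (intro tendsto_intros assms)

lemma tendsto_matrix_inv:
  fixes R :: "complex \<Rightarrow> complex ^ 'm::finite ^ 'm"
  assumes "(R \<longlongrightarrow> A) net" "det A \<noteq> 0"
  shows "((\<lambda>z. matrix_inv (R z)) \<longlongrightarrow> matrix_inv A) net"
proof (intro vec_tendstoI)
  fix i j
  have ent: "((\<lambda>z. R z $ i $ j) \<longlongrightarrow> A $ i $ j) net" for i j
    by (intro tendsto_vec_nth assms(1))
  have "((\<lambda>z. det (R z)) \<longlongrightarrow> det A) net" by (rule tendsto_det[OF ent])
  then have "\<forall>\<^sub>F z in net. det (R z) \<noteq> 0"
    using assms(2) by (rule tendsto_imp_eventually_ne)
  then have "\<forall>\<^sub>F z in net. det (\<chi> k l. if l = i then mat 1 $ k $ j else R z $ k $ l) / det (R z)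
      = matrix_inv (R z) $ i $ j"
    by eventually_elim (simp add: matrix_inv_nth_cramer)
  moreover have "((\<lambda>z. det (\<chi> k l. if l = i then mat 1 $ k $ j else R z $ k $ l) / det (R z))
      \<longlongrightarrow> matrix_inv A $ i $ j) net"
    unfolding matrix_inv_nth_cramer[OF assms(2)]
    by (intro tendsto_divide tendsto_det ent assms(2)) (simp add: ent)
  ultimately show "((\<lambda>z. matrix_inv (R z) $ i $ j) \<longlongrightarrow> matrix_inv A $ i $ j) net"
    by (rule Lim_transform_eventually[rotated])
qed

section \<open>Uniqueness of a generic function with given semiresidual matrices\<close>

lemma mat_scalar_commute: "A ** (mat c ** B) = mat c ** (A ** B)"
  for A :: "complex ^ 'n ^ 'm" and B :: "complex ^ 'k ^ 'n"
proof -
  have "(A ** (mat c ** B)) $ i $ j = c * (A ** B) $ i $ j" for i j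
    unfolding matrix_matrix_mult_def[of A]
    by (simp add: mat_scalar_mult_nth sum_distrib_left ac_simps)
  then show ?thesis by (simp add: vec_eq_iff mat_scalar_mult_nth)
qed

text \<open>Multiply \<open>T R = I\<close> by \<open>z - s\<close> and let \<open>z\<close> tend to \<open>s\<close>.\<close>

lemma residue_right_factor_annihilated:
  fixes R T :: "complex \<Rightarrow> complex ^ 'm::finite ^ 'm"
  assumes "mat_analytic_at N s" "\<forall>\<^sub>F z in at s. T z = N z"
    and "mat_analytic_at M s" "\<forall>\<^sub>F z in at s. M z = mat (z - s) ** R z"
    and "\<forall>\<^sub>F z in at s. T z ** R z = mat 1"
  shows "N s ** M s = 0"
proof -
  have "\<forall>\<^sub>F z in at s. N z ** M z = mat (z - s) ** mat 1"
    using assms(2,4,5) by eventually_elim (simp add: mat_scalar_commute)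
  then have "N s ** M s = mat (s - s) ** mat 1"
    by (intro mat_analytic_eq_at_limit[OF mat_analytic_at_mult[OF assms(1,3)]]
        mat_analytic_at_scalar_mult) (auto simp: mat_analytic_at_def)
  then show ?thesis by (simp add: vec_eq_iff mat_scalar_mult_nth)
qed

text \<open>The mirror image of the preceding lemma: here the left factor has the pole.\<close>

lemma residue_left_factor_annihilated:
  fixes R T :: "complex \<Rightarrow> complex ^ 'm::finite ^ 'm"
  assumes "mat_analytic_at N s" "\<forall>\<^sub>F z in at s. R z = N z"
    and "mat_analytic_at M s" "\<forall>\<^sub>F z in at s. M z = mat (z - s) ** T z"
    and "\<forall>\<^sub>F z in at s. T z ** R z = mat 1"
  shows "M s ** N s = 0"
proof -
  have "\<forall>\<^sub>F z in at s. M z ** N z = mat (z - s) ** mat 1"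
    using assms(2,4,5) by eventually_elim (simp add: matrix_mul_assoc[symmetric])
  then have "M s ** N s = mat (s - s) ** mat 1"
    by (intro mat_analytic_eq_at_limit[OF mat_analytic_at_mult[OF assms(3,1)]]
        mat_analytic_at_scalar_mult) (auto simp: mat_analytic_at_def)
  then show ?thesis by (simp add: vec_eq_iff mat_scalar_mult_nth)
qed

text \<open>Annihilating a nonzero product \<open>u v\<close> of a column and a row from the left only concerns the
  column \<open>u\<close>, so the row may be exchanged.\<close>

lemma annihilates_outer_product_left:
  fixes X :: "complex ^ 'n ^ 'm"
  assumes "X ** (\<chi> i j. u $ i * v $ j) = 0" "(\<chi> i j. u $ i * v $ j) \<noteq> (0 :: complex ^ 'k ^ 'n)"
  shows "X ** (\<chi> i j. u $ i * w $ j) = (0 :: complex ^ 'l ^ 'm)"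
proof -
  have prod: "(X ** (\<chi> i j. u $ i * y $ j)) $ i $ j = (X *v u) $ i * y $ j" for y i j
    by (simp add: matrix_matrix_mult_def matrix_vector_mult_def sum_distrib_right sum_distrib_left ac_simps)
  obtain j where "v $ j \<noteq> 0" using assms(2) by (auto simp: vec_eq_iff)
  then have "(X *v u) $ i = 0" for i
    using prod[of v i j] assms(1) by simp
  then show ?thesis by (simp add: vec_eq_iff prod)
qed

lemma annihilates_outer_product_right:
  fixes X :: "complex ^ 'n ^ 'm"
  assumes "(\<chi> i j. u $ i * v $ j) ** X = 0" "(\<chi> i j. u $ i * v $ j) \<noteq> (0 :: complex ^ 'm ^ 'k)"
  shows "(\<chi> i j. w $ i * v $ j) ** X = (0 :: complex ^ 'n ^ 'l)"
proof -
  have prod: "((\<chi> i j. y $ i * v $ j) ** X) $ i $ j = y $ i * (v v* X) $ j" for y i j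
    by (simp add: matrix_matrix_mult_def vector_matrix_mult_def sum_distrib_right sum_distrib_left ac_simps)
  obtain i where "u $ i \<noteq> 0" using assms(2) by (auto simp: vec_eq_iff)
  then have "(v v* X) $ j = 0" for j
    using prod[of u i j] assms(1) by simp
  then show ?thesis by (simp add: vec_eq_iff prod)
qed

text \<open>The quotient \<open>R1\<^sup>-\<^sup>1 R2\<close> has only removable singularities: at each pole or zero, its
  residue contains the product of a regular factor with the one vector \<open>u\<close> that both residues
  share, and this product vanishes. The complementary vectors \<open>v\<close> and \<open>w\<close> may a priori differ.\<close>

theorem generic_eq_if_same_semiresiduals:
  fixes R1 R2 :: "complex \<Rightarrow> complex ^ 'm::finite ^ 'm"
  assumes gen: "generic R1" "generic R2"
    and poles: "\<And>s. pole_of R1 s \<longleftrightarrow> pole_of R2 s"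
    and zeros: "\<And>s. zero_of R1 s \<longleftrightarrow> zero_of R2 s"
    and left: "\<And>s. pole_of R1 s \<Longrightarrow> \<exists>u v w. mat_residue R1 s = (\<chi> i j. u $ i * v $ j)
          \<and> mat_residue R2 s = (\<chi> i j. u $ i * w $ j)"
    and right: "\<And>s. zero_of R1 s \<Longrightarrow> \<exists>u v w. mat_residue (mat_inverse R1) s = (\<chi> i j. v $ i * u $ j)
          \<and> mat_residue (mat_inverse R2) s = (\<chi> i j. w $ i * u $ j)"
    and lim: "(R1 \<longlongrightarrow> mat 1) at_infinity" "(R2 \<longlongrightarrow> mat 1) at_infinity"
  shows "R1 = R2"
proof -
  define Q where "Q z = mat_inverse R1 z ** R2 z" for z
  have inv: "\<forall>\<^sub>F z in at s. mat_inverse R z ** R z = mat 1" if "generic R"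
    for R :: "complex \<Rightarrow> complex ^ 'm ^ 'm" and s
    using generic_eventually_det_nonzero[OF that]
    by eventually_elim (simp add: mat_inverse_def matrix_inv_right_det matrix_left_right_inverse1)
  have Q_holo: "mat_holo_at Q s" for s
  proof (cases "pole_of R1 s")
    case True
    obtain N where N: "mat_analytic_at N s" "\<forall>\<^sub>F z in at s. mat_inverse R1 z = N z"
      using True unfolding pole_of_def mat_holo_at_iff by blast
    obtain M1 where M1: "mat_analytic_at M1 s" "\<forall>\<^sub>F z in at s. M1 z = mat (z - s) ** R1 z"
      "M1 s = mat_residue R1 s" "M1 s \<noteq> 0"
      using True mat_simple_poleE[of R1 s] unfolding pole_of_def by blast
    obtain M2 where M2: "mat_analytic_at M2 s" "\<forall>\<^sub>F z in at s. M2 z = mat (z - s) ** R2 z"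
      "M2 s = mat_residue R2 s"
      using True mat_simple_poleE[of R2 s] unfolding poles unfolding pole_of_def by blast
    \<comment> \<open>The inverse of \<open>R1\<close> kills the column of the residue of \<open>R1\<close>, which is that of \<open>R2\<close> as well.\<close>
    have "N s ** M1 s = 0"
      by (rule residue_right_factor_annihilated[OF N M1(1,2) inv[OF gen(1)]])
    then have "N s ** M2 s = 0"
      using left[OF True] M1(3,4) M2(3) annihilates_outer_product_left by metis
    moreover have "\<forall>\<^sub>F z in at s. N z ** M2 z = mat (z - s) ** Q z"
      using N(2) M2(2) by eventually_elim (simp add: Q_def mat_scalar_commute)
    ultimately show ?thesis
      using removable_if_residue_zero[OF mat_analytic_at_mult[OF N(1) M2(1)]] by blast
  next
    case not_pole: False
    show ?thesis
    proof (cases "zero_of R1 s")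
      case True
      obtain N where N: "mat_analytic_at N s" "\<forall>\<^sub>F z in at s. R2 z = N z"
        using True unfolding zeros unfolding zero_of_def mat_holo_at_iff by blast
      obtain M1 where M1: "mat_analytic_at M1 s" "\<forall>\<^sub>F z in at s. M1 z = mat (z - s) ** mat_inverse R1 z"
        "M1 s = mat_residue (mat_inverse R1) s"
        using True mat_simple_poleE[of "mat_inverse R1" s] unfolding zero_of_def by blast
      obtain M2 where M2: "mat_analytic_at M2 s" "\<forall>\<^sub>F z in at s. M2 z = mat (z - s) ** mat_inverse R2 z"
        "M2 s = mat_residue (mat_inverse R2) s" "M2 s \<noteq> 0"
        using True mat_simple_poleE[of "mat_inverse R2" s] unfolding zeros unfolding zero_of_def by blast
      \<comment> \<open>The row of the residue of \<open>R2\<^sup>-\<^sup>1\<close>, shared with \<open>R1\<^sup>-\<^sup>1\<close>, kills \<open>R2\<close>.\<close>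
      have "M2 s ** N s = 0"
        by (rule residue_left_factor_annihilated[OF N M2(1,2) inv[OF gen(2)]])
      then have "M1 s ** N s = 0"
        using right[OF True] M1(3) M2(3,4) annihilates_outer_product_right by metis
      moreover have "\<forall>\<^sub>F z in at s. M1 z ** N z = mat (z - s) ** Q z"
        using N(2) M1(2) by eventually_elim (simp add: Q_def matrix_mul_assoc)
      ultimately show ?thesis
        using removable_if_residue_zero[OF mat_analytic_at_mult[OF M1(1) N(1)]] by blast
    next
      case False
      then have "regular_point R1 s" "regular_point R2 s"
        using gen not_pole poles[of s] zeros[of s] unfolding generic_def by blast+
      then show ?thesis
        unfolding Q_def regular_point_def by (intro mat_holo_at_mult) auto
    qed
  qed
  have "(mat_inverse R1 \<longlongrightarrow> matrix_inv (mat 1)) at_infinity"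
    unfolding mat_inverse_def by (intro tendsto_matrix_inv lim) simp
  then have lim_inv: "(mat_inverse R1 \<longlongrightarrow> mat 1) at_infinity"
    by (simp add: matrix_inv_unique)
  have "((\<lambda>z. Q z $ i $ j) \<longlongrightarrow> (mat 1 ** mat 1 :: complex ^ 'm ^ 'm) $ i $ j) at_infinity" for i j
    unfolding Q_def matrix_matrix_mult_def vec_lambda_beta
    by (intro tendsto_sum tendsto_mult tendsto_vec_nth lim(2) lim_inv)
  then have Q_lim: "((\<lambda>z. Q z $ i $ j) \<longlongrightarrow> mat 1 $ i $ j) at_infinity" for i j
    by simp
  have "\<forall>\<^sub>F z in at 0. Q z $ i $ j = mat 1 $ i $ j" for i j
    using Liouville_removable[OF _ Q_lim[of i j]] Q_holo unfolding mat_holo_at_def by blast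
  then have "\<forall>\<^sub>F z in at 0. \<forall>i j. Q z $ i $ j = mat 1 $ i $ j"
    by (simp add: eventually_all_finite)
  then have R12: "\<forall>\<^sub>F z in at 0. R1 z = R2 z"
    using generic_eventually_det_nonzero[OF gen(1), of 0]
  proof eventually_elim
    case (elim z)
    then have "Q z = mat 1" by (simp add: vec_eq_iff)
    then have "R1 z ** (matrix_inv (R1 z) ** R2 z) = R1 z"
      by (simp add: Q_def mat_inverse_def)
    then show ?case
      unfolding matrix_mul_assoc matrix_inv_right_det[OF elim(2)] by simp
  qed
  have "(\<lambda>z. R1 z $ i $ j) = (\<lambda>z. R2 z $ i $ j)" for i j
  proof (rule rational_fun_eqI)
    show "\<forall>\<^sub>F z in at 0. R1 z $ i $ j = R2 z $ i $ j"
      using R12 by eventually_elim simp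
  qed (use gen in \<open>auto simp: generic_def rational_mat_fun_def\<close>)
  then show ?thesis by (auto simp: fun_eq_iff vec_eq_iff)
qed

text \<open>The order of the poles and zeros is fixed by the diagonals of \<open>A\<close> and \<open>B\<close>, which is how the
  columns of \<open>F\<close> and the rows of \<open>G\<close> are attached to the residues of both functions.\<close>

lemma family_member_unique:
  fixes R1 R2 :: "complex \<Rightarrow> complex ^ 'm::finite ^ 'm" and A B :: "complex ^ 'n::finite ^ 'n"
  assumes "generic R1" "generic R2"
    and poles: "has_pole_matrix R1 A" "has_pole_matrix R2 A"
    and zeros: "has_zero_matrix R1 B" "has_zero_matrix R2 B"
    and left: "left_pole_semiresidual R1 A F" "left_pole_semiresidual R2 A F"
    and right: "right_zero_semiresidual R1 B G" "right_zero_semiresidual R2 B G"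
    and lim: "(R1 \<longlongrightarrow> mat 1) at_infinity" "(R2 \<longlongrightarrow> mat 1) at_infinity"
  shows "R1 = R2"
proof -
  have poles: "{s. pole_of R s} = range (\<lambda>k. A $ k $ k)" if "has_pole_matrix R A"
    for R :: "complex \<Rightarrow> complex ^ 'm ^ 'm"
    using that unfolding has_pole_matrix_def bij_betw_def by (auto simp: diag_mat_nth)
  have zeros: "{s. zero_of R s} = range (\<lambda>k. B $ k $ k)" if "has_zero_matrix R B"
    for R :: "complex \<Rightarrow> complex ^ 'm ^ 'm"
    using that unfolding has_zero_matrix_def bij_betw_def by (auto simp: diag_mat_nth)
  show ?thesis
  proof (rule generic_eq_if_same_semiresiduals)
    show "pole_of R1 s \<longleftrightarrow> pole_of R2 s" for s
      using poles[OF assms(3)] poles[OF assms(4)] by blast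
    show "zero_of R1 s \<longleftrightarrow> zero_of R2 s" for s
      using zeros[OF assms(5)] zeros[OF assms(6)] by blast
  next
    fix s assume "pole_of R1 s"
    then obtain k where k: "s = A $ k $ k" using poles[OF assms(3)] by auto
    have "\<exists>g. mat_residue R s = (\<chi> i j. column k F $ i * g $ j)"
      if "left_pole_semiresidual R A F" for R
      using that unfolding left_pole_semiresidual_def k column_def vec_lambda_beta by blast
    from this[OF left(1)] this[OF left(2)] show "\<exists>u v w. mat_residue R1 s = (\<chi> i j. u $ i * v $ j) \<and> mat_residue R2 s = (\<chi> i j. u $ i * w $ j)"
      by blast
  next
    fix s assume "zero_of R1 s"
    then obtain k where k: "s = B $ k $ k" using zeros[OF assms(5)] by auto
    have "\<exists>f. mat_residue (mat_inverse R) s = (\<chi> i j. f $ i * row k G $ j)"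
      if "right_zero_semiresidual R B G" for R
      using that unfolding right_zero_semiresidual_def k row_def vec_lambda_beta by blast
    from this[OF right(1)] this[OF right(2)] show "\<exists>u v w. mat_residue (mat_inverse R1) s = (\<chi> i j. v $ i * u $ j)
        \<and> mat_residue (mat_inverse R2) s = (\<chi> i j. w $ i * u $ j)"
      by blast
  qed fact+
qed

section \<open>Existence of a generic function with given semiresidual matrices\<close>

lemma realization_analytic:
  assumes "\<And>k. s \<noteq> p k"
  shows "mat_analytic_at (realization p A B) s"
  unfolding mat_analytic_at_def realization_nth
  by (intro allI analytic_intros) (use assms in auto)

text \<open>Off the pole, \<open>(z - p k)\<close> times the realization equals a function that is regular at \<open>p k\<close>,
  because all other partial fractions are.\<close>

lemma realization_pole:
  fixes A :: "complex ^ 'n::finite ^ 'm::finite"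
  assumes "inj p"
  shows "\<exists>M. mat_analytic_at M (p k)
    \<and> (\<forall>\<^sub>F z in at (p k). M z = mat (z - p k) ** realization p A B z)
    \<and> M (p k) = (\<chi> i j. A $ i $ k * B $ k $ j)"
proof -
  define rest where "rest i j z = mat 1 $ i $ j + (\<Sum>l\<in>UNIV - {k}. A $ i $ l * B $ l $ j / (z - p l))"
    for i j z
  define M where "M z = (\<chi> i j. A $ i $ k * B $ k $ j + (z - p k) * rest i j z)" for z
  have "rest i j analytic_on {p k}" for i j
    unfolding rest_def by (intro analytic_intros) (use assms in \<open>auto simp: inj_def\<close>)
  then have "mat_analytic_at M (p k)"
    unfolding mat_analytic_at_def M_def by (auto intro!: analytic_intros)
  moreover have "\<forall>\<^sub>F z in at (p k). z \<noteq> p k" by (simp add: eventually_at_filter)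
  then have "\<forall>\<^sub>F z in at (p k). M z = mat (z - p k) ** realization p A B z"
  proof eventually_elim
    case (elim z)
    have "realization p A B z $ i $ j = A $ i $ k * B $ k $ j / (z - p k) + rest i j z" for i j
      unfolding realization_nth rest_def by (subst sum.remove[of UNIV k]) auto
    then show ?case
      using elim by (simp add: M_def vec_eq_iff mat_scalar_mult_nth distrib_left)
  qed
  moreover have "M (p k) = (\<chi> i j. A $ i $ k * B $ k $ j)"
    by (simp add: M_def)
  ultimately show ?thesis by blast
qed

text \<open>In the coordinate \<open>w = 1 / z\<close> a partial fraction \<open>1 / (z - p)\<close> becomes \<open>w / (1 - p w)\<close>.\<close>

lemma realization_at_infinity:
  fixes A :: "complex ^ 'n::finite ^ 'm::finite"
  shows "mat_holo_at_infinity (realization p A B)"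
    and "(realization p A B \<longlongrightarrow> mat 1) at_infinity"
proof -
  have eq: "realization p A B (inverse w) $ i $ j =
      mat 1 $ i $ j + (\<Sum>k\<in>UNIV. A $ i $ k * B $ k $ j * (w / (1 - p k * w)))" if "w \<noteq> 0" for w i j
  proof -
    have "1 / (inverse w - p k) = w / (1 - p k * w)" for k
      using that by (cases "1 - p k * w = 0") (auto simp: field_simps)
    then have "c / (inverse w - p k) = c * (w / (1 - p k * w))" for c k
      by (metis mult.right_neutral times_divide_eq_right)
    then show ?thesis unfolding realization_nth by simp
  qed
  have "\<exists>h. h analytic_on {0} \<and> (\<forall>\<^sub>F w in at 0. realization p A B (inverse w) $ i $ j = h w)" for i j
  proof (intro exI conjI)
    show "(\<lambda>w. mat 1 $ i $ j + (\<Sum>k\<in>UNIV. A $ i $ k * B $ k $ j * (w / (1 - p k * w)))) analytic_on {0}"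
      by (intro analytic_intros) auto
  qed (use eq in \<open>simp add: eventually_at_filter\<close>)
  then show "mat_holo_at_infinity (realization p A B)"
    unfolding mat_holo_at_infinity_def mat_holo_at_def by blast
  have lim: "((\<lambda>z. A $ i $ k * B $ k $ j / (z - p k)) \<longlongrightarrow> 0) at_infinity" for i j k
  proof -
    have "filterlim (\<lambda>z. (- p k) + z) at_infinity at_infinity"
      by (rule tendsto_add_filterlim_at_infinity[OF tendsto_const filterlim_ident])
    then show ?thesis
      by (intro tendsto_divide_0[OF tendsto_const]) simp
  qed
  have "((\<lambda>z. realization p A B z $ i $ j) \<longlongrightarrow> mat 1 $ i $ j + (\<Sum>k\<in>(UNIV :: 'n set). 0)) at_infinity" for i j
    unfolding realization_nth by (intro tendsto_add tendsto_const tendsto_sum lim)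
  then show "(realization p A B \<longlongrightarrow> mat 1) at_infinity"
    by (intro vec_tendstoI) simp
qed

text \<open>If column \<open>k\<close> of \<open>F\<close> or row \<open>k\<close> of \<open>G\<close> vanished, the Lyapunov equation would make the
  corresponding column or row of \<open>S\<close> zero. For \<open>T G\<close> and \<open>F T\<close> the same argument works with the
  equation \<open>T A\<^sub>Z - A\<^sub>P T = T G F T\<close>, obtained by multiplying with \<open>T\<close> on both sides. These rows and
  columns are the factors of the residues of \<open>R\<close> and \<open>R\<^sup>-\<^sup>1\<close>.\<close>

lemma coupled_products_nonzero:
  fixes S T :: "complex ^ 'n::finite ^ 'n" and F :: "complex ^ 'n ^ 'm::finite"
  assumes lyap: "diag_mat q ** S - S ** diag_mat p = G ** F" and T: "S ** T = mat 1"
    and pq: "\<And>i j. q i \<noteq> p j"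
  shows "\<exists>i. F $ i $ k \<noteq> 0" "\<exists>j. (T ** G) $ k $ j \<noteq> 0"
    and "\<exists>i. (F ** T) $ i $ k \<noteq> 0" "\<exists>j. G $ k $ j \<noteq> 0"
proof -
  have TS: "T ** S = mat 1" using T by (rule matrix_left_right_inverse1)
  have S: "S $ i $ j = (G ** F) $ i $ j / (q i - p j)" for i j
    using lyap lyapunov_diag_iff[of q p S "G ** F"] pq by blast
  have "(T ** G) ** (F ** T) = T ** (G ** F) ** T" by (simp add: matrix_mul_assoc)
  also have "\<dots> = (T ** diag_mat q) ** (S ** T) - (T ** S) ** (diag_mat p ** T)"
    unfolding lyap[symmetric]
    by (simp add: matrix_mul_assoc matrix_diff_ldistrib matrix_diff_rdistrib)
  finally have TGFT: "(T ** G) ** (F ** T) = T ** diag_mat q - diag_mat p ** T"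
    by (simp add: T TS)
  have T': "((T ** G) ** (F ** T)) $ i $ j = (q j - p i) * T $ i $ j" for i j
    unfolding TGFT by (simp add: mult_diag_mat_nth diag_mat_mult_nth algebra_simps)
  have ST1: "(\<Sum>i\<in>UNIV. S $ k $ i * T $ i $ k) = 1"
    using T by (simp add: matrix_matrix_mult_def vec_eq_iff mat_def)
  have TS1: "(\<Sum>i\<in>UNIV. T $ k $ i * S $ i $ k) = 1"
    using TS by (simp add: matrix_matrix_mult_def vec_eq_iff mat_def)
  show "\<exists>i. F $ i $ k \<noteq> 0"
  proof (rule ccontr)
    assume "\<not> ?thesis"
    then have "S $ i $ k = 0" for i unfolding S by (simp add: matrix_matrix_mult_def)
    then show False using TS1 by simp
  qed
  show "\<exists>j. G $ k $ j \<noteq> 0"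
  proof (rule ccontr)
    assume "\<not> ?thesis"
    then have "S $ k $ i = 0" for i unfolding S by (simp add: matrix_matrix_mult_def)
    then show False using ST1 by simp
  qed
  show "\<exists>j. (T ** G) $ k $ j \<noteq> 0"
  proof (rule ccontr)
    assume "\<not> ?thesis"
    then have "((T ** G) ** (F ** T)) $ k $ j = 0" for j
      by (simp add: matrix_matrix_mult_def[of "T ** G"])
    then have "T $ k $ j = 0" for j using T'[of k j] pq[of j k] by simp
    then show False using TS1 by simp
  qed
  show "\<exists>i. (F ** T) $ i $ k \<noteq> 0"
  proof (rule ccontr)
    assume "\<not> ?thesis"
    then have "((T ** G) ** (F ** T)) $ j $ k = 0" for j
      by (simp add: matrix_matrix_mult_def[of "T ** G"])
    then have "T $ j $ k = 0" for j using T'[of j k] pq[of k j] by simp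
    then show False using ST1 by simp
  qed
qed

lemma eventually_at_avoids_finitely_many:
  fixes p :: "'n::finite \<Rightarrow> complex"
  shows "\<forall>\<^sub>F z in at s. \<forall>k. z \<noteq> p k"
proof -
  have "\<forall>\<^sub>F z in at s. z \<noteq> p k" for k
    using eventually_poly_nonzero[of "[:- p k, 1:]" s] by simp
  then show ?thesis by (simp add: eventually_all_finite)
qed

lemma simple_pole_of_realization:
  fixes A :: "complex ^ 'n::finite ^ 'm::finite"
  assumes R: "\<forall>\<^sub>F z in at (p k). R z = realization p A B z"
    and "inj p" "\<exists>i. A $ i $ k \<noteq> 0" "\<exists>j. B $ k $ j \<noteq> 0"
  shows "mat_simple_pole R (p k)" "mat_residue R (p k) = (\<chi> i j. A $ i $ k * B $ k $ j)"
    "rank (mat_residue R (p k)) = 1"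
proof -
  obtain M where M: "mat_analytic_at M (p k)" "M (p k) = (\<chi> i j. A $ i $ k * B $ k $ j)"
    and MR: "\<forall>\<^sub>F z in at (p k). M z = mat (z - p k) ** realization p A B z"
    using realization_pole[OF assms(2)] by blast
  have MR: "\<forall>\<^sub>F z in at (p k). M z = mat (z - p k) ** R z"
    using MR R by eventually_elim simp
  have "M (p k) \<noteq> 0" using assms(3,4) by (auto simp: M(2) vec_eq_iff)
  then show "mat_simple_pole R (p k)" using mat_simple_poleI[OF M(1) MR] by blast
  show res: "mat_residue R (p k) = (\<chi> i j. A $ i $ k * B $ k $ j)"
    using mat_residue_eq[OF M(1) MR] M(2) by simp
  have "rank (\<chi> i j. column k A $ i * row k B $ j) = 1"
    by (rule rank_outer_product) (use assms(3,4) in \<open>auto simp: vec_eq_iff column_def row_def\<close>)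
  then show "rank (mat_residue R (p k)) = 1"
    by (simp add: res column_def row_def)
qed

text \<open>The required function is the realization with every entry replaced by its reduced fraction,
  which changes values only at the poles.\<close>

lemma realization_family_member:
  fixes F :: "complex ^ 'n::finite ^ 'm::finite" and S :: "complex ^ 'n ^ 'n"
  assumes "inj p" "inj q" and pq: "\<And>i j. q i \<noteq> p j"
    and lyap: "diag_mat q ** S - S ** diag_mat p = G ** F" and "det S \<noteq> 0"
  defines "T \<equiv> matrix_inv S"
  shows "\<exists>R. generic R \<and> has_pole_matrix R (diag_mat p) \<and> has_zero_matrix R (diag_mat q)
    \<and> left_pole_semiresidual R (diag_mat p) F \<and> right_zero_semiresidual R (diag_mat q) G
    \<and> (R \<longlongrightarrow> mat 1) at_infinity
    \<and> (\<forall>z. (\<forall>k. z \<noteq> p k) \<longrightarrow> R z = realization p F (- (T ** G)) z)"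
proof -
  have ST: "S ** T = mat 1" unfolding T_def using \<open>det S \<noteq> 0\<close> by (rule matrix_inv_right_det)
  \<comment> \<open>\<open>W\<close> is \<open>R\<close> up to the conventional values at the poles, and \<open>V\<close> is its inverse.\<close>
  define W where "W = realization p F (- (T ** G))"
  define V where "V = realization q (F ** T) G"
  define X where "X = {z. \<forall>k. z \<noteq> p k}"
  have WV: "W z ** V z = mat 1" if "\<forall>k. z \<noteq> p k" "\<forall>k. z \<noteq> q k" for z
    unfolding W_def V_def using that by (intro realization_inverse[OF lyap ST]) auto
  have "rational_on X (\<lambda>z. W z $ i $ j)" for i j
    unfolding W_def realization_nth
    by (intro rational_on_add rational_on_const rational_on_sum rational_on_simple_fraction)
      (auto simp: X_def)
  moreover have "X \<noteq> {}"
    using eventually_happens[OF eventually_at_avoids_finitely_many[of p 0]] by (auto simp: X_def)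
  ultimately have "\<forall>i j. \<exists>g. rational_fun g \<and> (\<forall>z\<in>X. g z = W z $ i $ j)"
    using rational_on_imp_rational_fun by blast
  then obtain r where r: "\<And>i j. rational_fun (r i j)" "\<And>i j z. z \<in> X \<Longrightarrow> r i j z = W z $ i $ j"
    by metis
  define R :: "complex \<Rightarrow> complex ^ 'm ^ 'm" where "R z = (\<chi> i j. r i j z)" for z
  have R_eq: "R z = W z" if "\<forall>k. z \<noteq> p k" for z
    using that r(2) by (simp add: R_def vec_eq_iff X_def)
  have "rational_mat_fun R" using r(1) by (simp add: rational_mat_fun_def R_def)
  have R_ev: "\<forall>\<^sub>F z in at s. R z = W z" for s
    using eventually_at_avoids_finitely_many[of p s] by eventually_elim (rule R_eq)
  have inv_eq: "mat_inverse R z = V z" if "\<forall>k. z \<noteq> p k" "\<forall>k. z \<noteq> q k" for z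
    unfolding mat_inverse_def R_eq[OF that(1)] by (rule matrix_inv_unique[OF WV[OF that]])
  have inv_ev: "\<forall>\<^sub>F z in at s. mat_inverse R z = V z" for s
    using eventually_at_avoids_finitely_many[of p s] eventually_at_avoids_finitely_many[of q s]
    by eventually_elim (rule inv_eq)
  have R_holo: "mat_holo_at R s" if "\<And>k. s \<noteq> p k" for s
    using R_ev by (rule mat_holo_at_cong) (use that in \<open>simp add: W_def mat_holo_atI realization_analytic\<close>)
  have inv_holo: "mat_holo_at (mat_inverse R) s" if "\<And>k. s \<noteq> q k" for s
    using inv_ev by (rule mat_holo_at_cong) (use that in \<open>simp add: V_def mat_holo_atI realization_analytic\<close>)
  note nonzero = coupled_products_nonzero[OF lyap ST pq]
  have nonzero': "\<exists>j. (- (T ** G)) $ k $ j \<noteq> 0" for k using nonzero(2)[of k] by simp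
  note R_pole = simple_pole_of_realization[OF R_ev[unfolded W_def] \<open>inj p\<close> nonzero(1) nonzero']
  note inv_pole = simple_pole_of_realization[OF inv_ev[unfolded V_def] \<open>inj q\<close> nonzero(3) nonzero(4)]
  have poles: "{s. pole_of R s} = range p"
  proof (intro set_eqI iffI)
    fix s assume "s \<in> {s. pole_of R s}"
    then show "s \<in> range p"
      using R_holo[of s] unfolding pole_of_def mat_simple_pole_def by blast
  next
    fix s assume "s \<in> range p"
    then obtain k where "s = p k" by blast
    then show "s \<in> {s. pole_of R s}"
      using R_pole(1)[of k] inv_holo[of s] pq unfolding pole_of_def by (metis mem_Collect_eq)
  qed
  have zeros: "{s. zero_of R s} = range q"
  proof (intro set_eqI iffI)
    fix s assume "s \<in> {s. zero_of R s}"
    then show "s \<in> range q"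
      using inv_holo[of s] unfolding zero_of_def mat_simple_pole_def by blast
  next
    fix s assume "s \<in> range q"
    then obtain k where "s = q k" by blast
    then show "s \<in> {s. zero_of R s}"
      using inv_pole(1)[of k] R_holo[of s] pq unfolding zero_of_def by (metis mem_Collect_eq)
  qed
  \<comment> \<open>Near infinity there are neither poles nor zeros, so \<open>R\<close> and \<open>R\<^sup>-\<^sup>1\<close> inherit the behaviour of \<open>W\<close> and \<open>V\<close>.\<close>
  have inf: "\<forall>\<^sub>F z in at_infinity. (\<forall>k. z \<noteq> p k) \<and> (\<forall>k. z \<noteq> q k)"
  proof -
    have "\<forall>\<^sub>F z in at_infinity. z \<noteq> c" for c :: complex
      unfolding eventually_at_infinity by (intro exI[of _ "norm c + 1"]) auto
    then show ?thesis by (simp add: eventually_all_finite eventually_conj)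
  qed
  have inverse_at_0: "filterlim inverse at_infinity (at (0::complex))"
    by (rule filterlim_inverse_at_infinity)
  have R_lim: "(R \<longlongrightarrow> mat 1) at_infinity"
    by (rule Lim_transform_eventually[OF realization_at_infinity(2)[of p F "- (T ** G)"]])
      (use inf in eventually_elim, use R_eq in \<open>simp add: W_def\<close>)
  have R_inf: "mat_holo_at_infinity R"
    unfolding mat_holo_at_infinity_def
  proof (rule mat_holo_at_cong)
    show "mat_holo_at (\<lambda>w. W (inverse w)) 0"
      using realization_at_infinity(1) unfolding W_def mat_holo_at_infinity_def by blast
    show "\<forall>\<^sub>F w in at 0. R (inverse w) = W (inverse w)"
      using eventually_compose_filterlim[OF inf inverse_at_0]
      by eventually_elim (use R_eq in blast)
  qed
  have inv_inf: "mat_holo_at_infinity (mat_inverse R)"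
    unfolding mat_holo_at_infinity_def
  proof (rule mat_holo_at_cong)
    show "mat_holo_at (\<lambda>w. V (inverse w)) 0"
      using realization_at_infinity(1) unfolding V_def mat_holo_at_infinity_def by blast
    show "\<forall>\<^sub>F w in at 0. mat_inverse R (inverse w) = V (inverse w)"
      using eventually_compose_filterlim[OF inf inverse_at_0]
      by eventually_elim (use inv_eq in blast)
  qed
  have "generic R"
    unfolding generic_def
  proof (intro conjI allI impI)
    obtain z where z: "(\<forall>k. z \<noteq> p k) \<and> (\<forall>k. z \<noteq> q k)"
      using eventually_happens[OF eventually_conj[OF eventually_at_avoids_finitely_many[of p 0]
            eventually_at_avoids_finitely_many[of q 0]]] by auto
    then show "\<exists>z. mat_holo_at R z \<and> det (R z) \<noteq> 0"
      using R_holo det_nonzero_if_right_inverse[OF WV] R_eq by metis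
    show "pole_of R s \<or> zero_of R s" if "\<not> regular_point R s" for s
      using that R_holo[of s] inv_holo[of s] poles zeros unfolding regular_point_def by blast
    show "rank (mat_residue R s) = 1" if "pole_of R s" for s
      using that poles R_pole(3) by (metis mem_Collect_eq rangeE)
    show "rank (mat_residue (mat_inverse R) s) = 1" if "zero_of R s" for s
      using that zeros inv_pole(3) by (metis mem_Collect_eq rangeE)
  qed fact+
  moreover have "has_pole_matrix R (diag_mat p)" "has_zero_matrix R (diag_mat q)"
    unfolding has_pole_matrix_def has_zero_matrix_def poles zeros
    using \<open>inj p\<close> \<open>inj q\<close> by (auto simp: bij_betw_def)
  moreover have "left_pole_semiresidual R (diag_mat p) F"
    unfolding left_pole_semiresidual_def
  proof
    fix k
    have "mat_residue R (diag_mat p $ k $ k) = (\<chi> i j. F $ i $ k * row k (- (T ** G)) $ j)"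
      using R_pole(2)[of k] by (simp add: diag_mat_nth row_def)
    then show "\<exists>g. mat_residue R (diag_mat p $ k $ k) = (\<chi> i j. F $ i $ k * g $ j)"
      by blast
  qed
  moreover have "right_zero_semiresidual R (diag_mat q) G"
    unfolding right_zero_semiresidual_def
  proof
    fix k
    have "mat_residue (mat_inverse R) (diag_mat q $ k $ k)
        = (\<chi> i j. column k (F ** T) $ i * G $ k $ j)"
      using inv_pole(2)[of k] by (simp add: diag_mat_nth column_def)
    then show "\<exists>f. mat_residue (mat_inverse R) (diag_mat q $ k $ k) = (\<chi> i j. f $ i * G $ k $ j)"
      by blast
  qed
  ultimately show ?thesis using R_lim R_eq unfolding W_def by blast
qed

lemma z_derivative_realization:
  fixes A :: "complex ^ 'n::finite ^ 'm::finite"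
  assumes z: "\<And>k. z \<noteq> p k" and R: "\<And>w. (\<And>k. w \<noteq> p k) \<Longrightarrow> R w = realization p A B w"
  defines "P \<equiv> diag_mat (\<lambda>k. 1 / (z - p k))"
  shows "z_derivative R z = - (A ** P ** P ** B)"
proof -
  have "\<forall>\<^sub>F w in nhds z. \<forall>k. w \<noteq> p k"
    using eventually_at_avoids_finitely_many[of p z] z by (simp add: eventually_nhds_conv_at)
  then have "\<forall>\<^sub>F w in nhds z. R w $ i $ j = realization p A B w $ i $ j" for i j
    by eventually_elim (simp add: R)
  then have "deriv (\<lambda>w. R w $ i $ j) z = deriv (\<lambda>w. realization p A B w $ i $ j) z" for i j
    by (intro deriv_cong_ev refl)
  moreover have "((\<lambda>w. realization p A B w $ i $ j) has_field_derivative
      (\<Sum>k\<in>UNIV. - (A $ i $ k * (1 / (z - p k) * (1 / (z - p k))) * B $ k $ j))) (at z)" for i j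
  proof -
    have "((\<lambda>w. A $ i $ k * B $ k $ j / (w - p k)) has_field_derivative
        - (A $ i $ k * (1 / (z - p k) * (1 / (z - p k))) * B $ k $ j)) (at z)" for k
      using z[of k] by (auto intro!: derivative_eq_intros simp: field_simps)
    then have "((\<lambda>w. mat 1 $ i $ j + (\<Sum>k\<in>UNIV. A $ i $ k * B $ k $ j / (w - p k))) has_field_derivative
      0 + (\<Sum>k\<in>UNIV. - (A $ i $ k * (1 / (z - p k) * (1 / (z - p k))) * B $ k $ j))) (at z)"
      by (intro DERIV_add DERIV_const DERIV_sum)
    then show ?thesis unfolding realization_nth by simp
  qed
  ultimately have "z_derivative R z $ i $ j =
      - (\<Sum>k\<in>UNIV. A $ i $ k * (1 / (z - p k) * (1 / (z - p k))) * B $ k $ j)" for i j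
    by (simp add: z_derivative_def DERIV_imp_deriv sum_negf)
  moreover have "A ** P ** P ** B = A ** diag_mat (\<lambda>k. 1 / (z - p k) * (1 / (z - p k))) ** B"
  proof -
    have "P ** P = diag_mat (\<lambda>k. 1 / (z - p k) * (1 / (z - p k)))"
      by (simp add: P_def vec_eq_iff diag_mat_mult_nth diag_mat_nth)
    then show ?thesis by (metis matrix_mul_assoc)
  qed
  ultimately show ?thesis by (simp add: vec_eq_iff diag_mat_sandwich_nth)
qed

text \<open>Here \<open>R' R\<^sup>-\<^sup>1 = F P\<^sup>2 T G (I + F T Q G)\<close>, and \<open>resolvent_coupling\<close> rewrites the quadratic term as
  \<open>F P (T Q - P T) G\<close>.\<close>

lemma logarithmic_derivative_realization:
  fixes F :: "complex ^ 'n::finite ^ 'm::finite" and S T :: "complex ^ 'n ^ 'n"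
  assumes lyap: "diag_mat q ** S - S ** diag_mat p = G ** F" and ST: "S ** T = mat 1"
    and z: "\<And>k. z \<noteq> p k" "\<And>k. z \<noteq> q k"
    and R: "\<And>w. (\<And>k. w \<noteq> p k) \<Longrightarrow> R w = realization p F (- (T ** G)) w"
  defines "P \<equiv> diag_mat (\<lambda>k. 1 / (z - p k))" and "Q \<equiv> diag_mat (\<lambda>k. 1 / (z - q k))"
  shows "z_derivative R z ** matrix_inv (R z) = F ** P ** T ** Q ** G"
proof -
  have "matrix_inv (R z) = realization q (F ** T) G z"
    unfolding R[OF z(1)] by (rule matrix_inv_unique[OF realization_inverse[OF lyap ST z]])
  moreover have "z_derivative R z = F ** P ** P ** T ** G"
    using z_derivative_realization[of z p R F "- (T ** G)"] z(1) R
    by (simp add: P_def[symmetric] matrix_minus_right matrix_mul_assoc)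
  ultimately have "z_derivative R z ** matrix_inv (R z)
      = F ** P ** P ** T ** G + F ** P ** (P ** T ** G ** F ** T ** Q) ** G"
    unfolding realization_def Q_def[symmetric]
    by (simp add: matrix_add_ldistrib matrix_mul_assoc)
  also have "P ** T ** G ** F ** T ** Q = T ** Q - P ** T"
    unfolding P_def Q_def by (rule resolvent_coupling[OF lyap ST z])
  also have "F ** P ** P ** T ** G + F ** P ** (T ** Q - P ** T) ** G = F ** P ** T ** Q ** G"
    by (simp add: matrix_diff_ldistrib matrix_diff_rdistrib matrix_mul_assoc)
  finally show ?thesis .
qed

section \<open>Holomorphic functions of several variables\<close>

lemma holo_on_const: "holo_on (\<lambda>_. c) U"
  unfolding holo_on_def by (intro ballI exI[of _ "\<lambda>_. 0"]) simp

lemma holo_on_coordinate: "holo_on (\<lambda>t :: complex ^ 'k. t $ k) U"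
  unfolding holo_on_def
proof
  fix t :: "complex ^ 'k"
  have "((\<lambda>t :: complex ^ 'k. t $ k) has_derivative (\<lambda>t. t $ k)) (at t)"
    by (intro bounded_linear_imp_has_derivative bounded_linear_vec_nth)
  then show "\<exists>f'. ((\<lambda>t. t $ k) has_derivative f') (at t) \<and> (\<forall>c h. f' (c *s h) = c * f' h)"
    by (intro exI[of _ "\<lambda>t. t $ k"]) simp
qed

lemma holo_on_add:
  assumes "holo_on f U" "holo_on g U"
  shows "holo_on (\<lambda>t. f t + g t) U"
  unfolding holo_on_def
proof
  fix t assume "t \<in> U"
  then obtain f' g' where "(f has_derivative f') (at t)" "\<forall>c h. f' (c *s h) = c * f' h"
    "(g has_derivative g') (at t)" "\<forall>c h. g' (c *s h) = c * g' h"
    using assms unfolding holo_on_def by meson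
  then show "\<exists>f'. ((\<lambda>t. f t + g t) has_derivative f') (at t) \<and> (\<forall>c h. f' (c *s h) = c * f' h)"
    by (intro exI[of _ "\<lambda>h. f' h + g' h"]) (auto intro!: has_derivative_add simp: algebra_simps)
qed

lemma holo_on_mult:
  assumes "holo_on f U" "holo_on g U"
  shows "holo_on (\<lambda>t. f t * g t) U"
  unfolding holo_on_def
proof
  fix t assume "t \<in> U"
  then obtain f' g' where "(f has_derivative f') (at t)" "\<forall>c h. f' (c *s h) = c * f' h"
    "(g has_derivative g') (at t)" "\<forall>c h. g' (c *s h) = c * g' h"
    using assms unfolding holo_on_def by meson
  then show "\<exists>f'. ((\<lambda>t. f t * g t) has_derivative f') (at t) \<and> (\<forall>c h. f' (c *s h) = c * f' h)"
    by (intro exI[of _ "\<lambda>h. f t * g' h + f' h * g t"]) (auto intro!: has_derivative_mult simp: algebra_simps)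
qed

lemma holo_on_inverse:
  assumes "holo_on f U" "\<And>t. t \<in> U \<Longrightarrow> f t \<noteq> 0"
  shows "holo_on (\<lambda>t. inverse (f t)) U"
  unfolding holo_on_def
proof
  fix t assume "t \<in> U"
  then obtain f' where "(f has_derivative f') (at t)" "\<forall>c h. f' (c *s h) = c * f' h"
    using assms unfolding holo_on_def by meson
  then show "\<exists>f'. ((\<lambda>t. inverse (f t)) has_derivative f') (at t) \<and> (\<forall>c h. f' (c *s h) = c * f' h)"
    by (intro exI[of _ "\<lambda>h. - (inverse (f t) * f' h * inverse (f t))"])
      (auto intro!: Deriv.has_derivative_inverse simp: assms(2)[OF \<open>t \<in> U\<close>])
qed

lemma holo_on_divide:
  assumes "holo_on f U" "holo_on g U" "\<And>t. t \<in> U \<Longrightarrow> g t \<noteq> 0"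
  shows "holo_on (\<lambda>t. f t / g t) U"
  unfolding divide_inverse by (intro holo_on_mult holo_on_inverse assms)

lemma holo_on_uminus: "holo_on f U \<Longrightarrow> holo_on (\<lambda>t. - f t) U"
  using holo_on_mult[OF holo_on_const[of "-1"]] by simp

lemma holo_on_diff: "holo_on f U \<Longrightarrow> holo_on g U \<Longrightarrow> holo_on (\<lambda>t. f t - g t) U"
  using holo_on_add[OF _ holo_on_uminus] by simp

lemma holo_on_sum: "(\<And>k. k \<in> K \<Longrightarrow> holo_on (f k) U) \<Longrightarrow> holo_on (\<lambda>t. \<Sum>k\<in>K. f k t) U"
  by (induction K rule: infinite_finite_induct) (auto intro: holo_on_const holo_on_add)

lemma holo_on_prod: "(\<And>k. k \<in> K \<Longrightarrow> holo_on (f k) U) \<Longrightarrow> holo_on (\<lambda>t. \<Prod>k\<in>K. f k t) U"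
  by (induction K rule: infinite_finite_induct) (auto intro: holo_on_const holo_on_mult)

lemma holo_on_subset: "holo_on f U \<Longrightarrow> V \<subseteq> U \<Longrightarrow> holo_on f V"
  unfolding holo_on_def by blast

lemma holo_on_cong:
  assumes "holo_on g U" "open U" "\<And>t. t \<in> U \<Longrightarrow> f t = g t"
  shows "holo_on f U"
  unfolding holo_on_def
proof
  fix t assume t: "t \<in> U"
  then obtain g' where g': "(g has_derivative g') (at t)" "\<forall>c h. g' (c *s h) = c * g' h"
    using assms(1) unfolding holo_on_def by meson
  then have "(f has_derivative g') (at t)"
    using has_derivative_transform_within_open[OF g'(1) assms(2) t] assms(3) by simp
  then show "\<exists>f'. (f has_derivative f') (at t) \<and> (\<forall>c h. f' (c *s h) = c * f' h)"
    using g'(2) by blast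
qed

lemma holo_on_det:
  "(\<And>i j. holo_on (\<lambda>t. M t $ i $ j) U) \<Longrightarrow> holo_on (\<lambda>t. det (M t)) U"
  unfolding det_def by (intro holo_on_sum holo_on_mult holo_on_prod holo_on_const)

lemma holo_on_matrix_mult_nth:
  "mat_holo_on M U \<Longrightarrow> mat_holo_on N U \<Longrightarrow> holo_on (\<lambda>t. (M t ** N t) $ i $ j) U"
  unfolding mat_holo_on_def matrix_matrix_mult_def by (auto intro!: holo_on_sum holo_on_mult)

lemma mat_holo_on_matrix_inv:
  fixes M :: "complex ^ 'k \<Rightarrow> complex ^ 'n ^ 'n"
  assumes "mat_holo_on M U" "open U" "\<And>t. t \<in> U \<Longrightarrow> det (M t) \<noteq> 0"
  shows "mat_holo_on (\<lambda>t. matrix_inv (M t)) U"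
  unfolding mat_holo_on_def
proof (intro allI)
  fix i j
  have M: "holo_on (\<lambda>t. M t $ k $ l) U" for k l using assms(1) by (simp add: mat_holo_on_def)
  have "holo_on (\<lambda>t. (\<chi> k l. if l = i then mat 1 $ k $ j else M t $ k $ l) $ k $ l) U" for k l
    using M[of k l] by (cases "l = i") (auto intro: holo_on_const)
  then have "holo_on (\<lambda>t. det (\<chi> k l. if l = i then mat 1 $ k $ j else M t $ k $ l) / det (M t)) U"
    by (intro holo_on_divide holo_on_det M assms(3))
  then show "holo_on (\<lambda>t. matrix_inv (M t) $ i $ j) U"
    by (rule holo_on_cong[OF _ assms(2)]) (rule matrix_inv_nth_cramer[OF assms(3)])
qed

lemma holo_on_imp_continuous_on: "holo_on f U \<Longrightarrow> continuous_on U f"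
  unfolding holo_on_def
  by (intro continuous_at_imp_continuous_on ballI) (metis has_derivative_continuous)

text \<open>Complex homogeneity of the derivative turns the chain rule along a complex line into
  complex differentiability.\<close>

lemma holo_on_line:
  assumes "holo_on f U"
  shows "(\<lambda>w. f (a + w *s v)) holomorphic_on {w. a + w *s v \<in> U}"
proof (rule holomorphic_onI)
  fix w assume "w \<in> {w. a + w *s v \<in> U}"
  then obtain f' where f': "(f has_derivative f') (at (a + w *s v))" "\<And>c h. f' (c *s h) = c * f' h"
    using assms unfolding holo_on_def by blast
  have "bounded_linear (\<lambda>w. w *s v)"
    unfolding linear_conv_bounded_linear[symmetric]
    by (intro linearI) (auto simp: vec_eq_iff algebra_simps)
  then have "((\<lambda>w. a + w *s v) has_derivative (\<lambda>h. h *s v)) (at w)"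
    by (auto intro!: derivative_eq_intros bounded_linear_imp_has_derivative)
  then have "((\<lambda>w. f (a + w *s v)) has_derivative (\<lambda>h. f' (h *s v))) (at w)"
    using has_derivative_compose f'(1) by blast
  then have "((\<lambda>w. f (a + w *s v)) has_field_derivative f' v) (at w)"
    by (simp add: has_field_derivative_def f'(2) mult_commute_abs)
  then show "(\<lambda>w. f (a + w *s v)) field_differentiable at w within {w. a + w *s v \<in> U}"
    unfolding field_differentiable_def using has_field_derivative_at_within by blast
qed

lemma continuous_on_line: "continuous_on UNIV (\<lambda>w :: complex. a + w *s (v :: complex ^ 'k))"
proof -
  have "linear (\<lambda>w :: complex. w *s v)"
    by (intro linearI) (auto simp: vec_eq_iff algebra_simps)
  then show ?thesis
    by (intro continuous_on_add continuous_on_const linear_continuous_on)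
      (simp add: linear_conv_bounded_linear)
qed

text \<open>Real convex combinations of points on a complex line stay on it.\<close>

lemma line_preimage_convex_open:
  fixes B :: "(complex ^ 'k) set"
  assumes "convex B" "open B"
  shows "convex {w. a + w *s v \<in> B}" "open {w. a + w *s v \<in> B}"
proof -
  show "open {w. a + w *s v \<in> B}"
    using open_vimage[OF assms(2) continuous_on_line[of a v]] by (simp add: vimage_def)
  show "convex {w. a + w *s v \<in> B}"
  proof (rule convexI)
    fix x y :: complex and s r :: real
    assume xy: "x \<in> {w. a + w *s v \<in> B}" "y \<in> {w. a + w *s v \<in> B}" and sr: "0 \<le> s" "0 \<le> r" "s + r = 1"
    have "s *\<^sub>R (a + x *s v) + r *\<^sub>R (a + y *s v) \<in> B"
      using assms(1) xy sr by (auto intro: convexD)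
    moreover have "s *\<^sub>R (a + x *s v) + r *\<^sub>R (a + y *s v)
        = (s + r) *\<^sub>R a + (s *\<^sub>R x + r *\<^sub>R y) *s v"
      by (simp add: vec_eq_iff algebra_simps)
    ultimately show "s *\<^sub>R x + r *\<^sub>R y \<in> {w. a + w *s v \<in> B}" using sr(3) by simp
  qed
qed

text \<open>Identity theorem: join a point of the open zero set to \<open>b\<close> by a complex line and continue
  analytically in one variable.\<close>

lemma holo_zero_on_convex:
  fixes f :: "complex ^ 'k \<Rightarrow> complex"
  assumes "holo_on f B" "convex B" "open B" "open W" "W \<subseteq> B" "W \<noteq> {}"
    and zero: "\<And>t. t \<in> W \<Longrightarrow> f t = 0" and "b \<in> B"
  shows "f b = 0"
proof -
  obtain a where "a \<in> W" using assms(6) by blast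
  define v where "v = b - a"
  define L where "L = {w. a + w *s v \<in> B}"
  note L = line_preimage_convex_open[OF assms(2,3), of a v, folded L_def]
  have "open {w. a + w *s v \<in> W}"
    using open_vimage[OF assms(4) continuous_on_line[of a v]] by (simp add: vimage_def)
  then have "f (a + 1 *s v) = 0"
  proof (rule analytic_continuation_open[where f = "\<lambda>w. f (a + w *s v)" and g = "\<lambda>_. 0" and s' = L and z = 1])
    show "{w. a + w *s v \<in> W} \<noteq> {}" using \<open>a \<in> W\<close> by (auto intro: exI[of _ 0])
    show "(\<lambda>w. f (a + w *s v)) holomorphic_on L" unfolding L_def by (rule holo_on_line[OF assms(1)])
    show "1 \<in> L" using \<open>b \<in> B\<close> by (simp add: L_def v_def)
  qed (use L assms(5) zero in \<open>auto simp: L_def intro: convex_connected\<close>)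
  then show ?thesis by (simp add: v_def)
qed

text \<open>Any two non-zeros lie on a complex line that meets the convex set in a plane region, from
  which the zeros remove only countably many points.\<close>

lemma connected_convex_minus_zeros:
  fixes f :: "complex ^ 'k \<Rightarrow> complex"
  assumes "holo_on f B" "convex B" "open B"
  shows "connected (B - {t. f t = 0})"
  unfolding connected_iff_connected_component
proof (intro ballI)
  fix a b assume ab: "a \<in> B - {t. f t = 0}" "b \<in> B - {t. f t = 0}"
  define v where "v = b - a"
  define L where "L = {w. a + w *s v \<in> B}"
  define Z where "Z = {w \<in> L. f (a + w *s v) = 0}"
  note L = line_preimage_convex_open[OF assms(2,3), of a v, folded L_def]
  have holo: "(\<lambda>w. f (a + w *s v)) holomorphic_on L"
    unfolding L_def by (rule holo_on_line[OF assms(1)])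
  have mem: "0 \<in> L" "f (a + 0 *s v) \<noteq> 0" "1 \<in> L" "f (a + 1 *s v) \<noteq> 0"
    using ab by (auto simp: L_def v_def)
  have "countable Z"
  proof (cases "(\<lambda>w. f (a + w *s v)) constant_on L")
    case True
    then have "f (a + w *s v) = f (a + 0 *s v)" if "w \<in> L" for w
      using that mem(1) unfolding constant_on_def by metis
    then have "Z = {}" using mem(2) by (auto simp: Z_def)
    then show ?thesis by simp
  next
    case False
    \<comment> \<open>The countability of the zeros rests on exhausting \<open>L\<close> by countably many closed sets.\<close>
    obtain C where C: "countable C" "\<And>X. X \<in> C \<Longrightarrow> \<exists>a b. X = cbox a b" "\<Union>C = L"
      using open_countable_Union_open_cbox[OF L(2)] by metis
    have "C \<noteq> {}" using C(3) mem(1) by blast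
    then have "L = (\<Union>n. from_nat_into C n)" using C(1,3) by (simp add: UN_from_nat_into)
    moreover have "closed (from_nat_into C n)" for n
      using C(2)[OF from_nat_into[OF \<open>C \<noteq> {}\<close>, of n]] closed_cbox by metis
    ultimately have "fsigma L" using fsigma.intros[of "from_nat_into C"] by simp
    then show ?thesis
      unfolding Z_def
      by (rule holomorphic_countable_zeros[OF holo L(2) convex_connected[OF L(1)] _ False])
  qed
  then have "connected (L - Z)"
    using connected_open_diff_countable[OF _ L(2) convex_connected[OF L(1)]] by simp
  then have "connected ((\<lambda>w. a + w *s v) ` (L - Z))"
    by (rule connected_continuous_image[rotated]) (rule continuous_on_subset[OF continuous_on_line], simp)
  moreover have "(\<lambda>w. a + w *s v) ` (L - Z) \<subseteq> B - {t. f t = 0}"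
    by (auto simp: L_def Z_def)
  moreover have "a \<in> (\<lambda>w. a + w *s v) ` (L - Z)" "b \<in> (\<lambda>w. a + w *s v) ` (L - Z)"
    using mem by (auto simp: Z_def v_def intro: image_eqI[where x = 0] image_eqI[where x = 1])
  ultimately show "connected_component (B - {t. f t = 0}) a b"
    unfolding connected_component_def by blast
qed

text \<open>A separation \<open>U\<close>, \<open>V\<close> of \<open>D - N\<close> would extend to one of \<open>D\<close>: each small set \<open>B - N\<close> lies in \<open>U\<close>
  or in \<open>V\<close>, and not in both since \<open>N\<close> has no interior.\<close>

lemma connected_diff_nowhere_dense:
  fixes D :: "'x::topological_space set"
  assumes "open D" "connected D"
    and local: "\<And>x. x \<in> D \<Longrightarrow> \<exists>B. open B \<and> x \<in> B \<and> B \<subseteq> D \<and> connected (B - N)"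
    and nowhere_dense: "\<And>W. open W \<Longrightarrow> W \<subseteq> D \<Longrightarrow> W \<subseteq> N \<Longrightarrow> W = {}"
    and "open (D - N)"
  shows "connected (D - N)"
proof (rule connectedI)
  fix U V
  assume UV: "open U" "open V" "U \<inter> (D - N) \<noteq> {}" "V \<inter> (D - N) \<noteq> {}" "U \<inter> V \<inter> (D - N) = {}" "D - N \<subseteq> U \<union> V"
  \<comment> \<open>Fill in the points of \<open>N\<close> near which \<open>D - N\<close> is contained in \<open>X\<close>.\<close>
  define span where "span X = \<Union>{B. open B \<and> B \<subseteq> D \<and> B - N \<subseteq> X}" for X
  have op: "open (span X)" for X unfolding span_def by auto
  have "D \<subseteq> span U \<union> span V"
  proof
    fix x assume "x \<in> D"
    then obtain B where B: "open B" "x \<in> B" "B \<subseteq> D" "connected (B - N)" using local by blast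
    have "B - N \<subseteq> U \<or> B - N \<subseteq> V"
      using connectedD[OF B(4) UV(1,2)] UV(5,6) B(3) by blast
    then show "x \<in> span U \<union> span V" using B unfolding span_def by blast
  qed
  moreover have "span U \<inter> span V \<inter> D = {}"
  proof -
    have "B \<inter> C = {}" if "open B" "B \<subseteq> D" "B - N \<subseteq> U" "open C" "C \<subseteq> D" "C - N \<subseteq> V" for B C
      using that UV(5) by (intro nowhere_dense) blast+
    then show ?thesis unfolding span_def by blast
  qed
  moreover have "U \<inter> (D - N) \<subseteq> span U" "V \<inter> (D - N) \<subseteq> span V"
    using UV(1,2) \<open>open (D - N)\<close> unfolding span_def by blast+
  then have "span U \<inter> D \<noteq> {}" "span V \<inter> D \<noteq> {}" using UV(3,4) by blast+
  ultimately show False using connectedD[OF \<open>connected D\<close> op op] by blast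
qed

text \<open>The set \<open>Z\<close> of interior points of \<open>N\<close> is open and, by the identity theorem on balls,
  closed in the domain. So it is empty or everything, and the latter contradicts that the local
  equations are nontrivial. Balls minus \<open>N\<close> are connected by
  \<open>connected_convex_minus_zeros\<close>, so \<open>connected_diff_nowhere_dense\<close> applies.\<close>

theorem is_domain_minus_local_zeros:
  fixes f :: "'a \<Rightarrow> complex ^ 'k \<Rightarrow> complex"
  assumes domain: "is_domain \<D>"
    and cover: "\<And>\<alpha>. \<alpha> \<in> I \<Longrightarrow> open (D \<alpha>)" "(\<Union>\<alpha>\<in>I. D \<alpha>) = \<D>"
    and holo: "\<And>\<alpha>. \<alpha> \<in> I \<Longrightarrow> holo_on (f \<alpha>) (D \<alpha>)"
    and zeros: "\<And>\<alpha> t. \<alpha> \<in> I \<Longrightarrow> t \<in> D \<alpha> \<Longrightarrow> t \<in> N \<longleftrightarrow> f \<alpha> t = 0"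
    and nontrivial: "\<And>\<alpha>. \<alpha> \<in> I \<Longrightarrow> \<exists>t\<in>D \<alpha>. f \<alpha> t \<noteq> 0"
  shows "is_domain (\<D> - N)"
proof -
  have "open \<D>" "connected \<D>" "\<D> \<noteq> {}" using domain by (auto simp: is_domain_def)
  have ball: "\<exists>\<alpha> B. \<alpha> \<in> I \<and> open B \<and> convex B \<and> t \<in> B \<and> B \<subseteq> D \<alpha>" if t: "t \<in> \<D>" for t
  proof -
    obtain \<alpha> where \<alpha>: "\<alpha> \<in> I" "t \<in> D \<alpha>" using t cover(2) by blast
    then obtain e where "e > 0" "ball t e \<subseteq> D \<alpha>"
      using cover(1) open_contains_ball by blast
    then show ?thesis using \<alpha> by (intro exI[of _ \<alpha>] exI[of _ "ball t e"]) auto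
  qed
  have "open {t \<in> D \<alpha>. f \<alpha> t \<noteq> 0}" if "\<alpha> \<in> I" for \<alpha>
    using continuous_open_preimage[OF holo_on_imp_continuous_on[OF holo[OF that]] cover(1)[OF that], of "- {0}"]
    by (simp add: vimage_def Int_def open_Compl)
  then have "open (\<Union>\<alpha>\<in>I. {t \<in> D \<alpha>. f \<alpha> t \<noteq> 0})" by (intro open_UN) blast
  moreover have "(\<Union>\<alpha>\<in>I. {t \<in> D \<alpha>. f \<alpha> t \<noteq> 0}) = \<D> - N"
    using cover(2) zeros by fastforce
  ultimately have op: "open (\<D> - N)" by simp
  define Z where "Z = \<Union>{W. open W \<and> W \<subseteq> \<D> \<and> W \<subseteq> N}"
  have "open Z" "Z \<subseteq> \<D>" "Z \<subseteq> N" unfolding Z_def by auto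
  have "t \<in> Z" if t: "t \<in> \<D>" "t \<in> closure Z" for t
  proof -
    obtain \<alpha> B where B: "\<alpha> \<in> I" "open B" "convex B" "t \<in> B" "B \<subseteq> D \<alpha>" using ball[OF t(1)] by blast
    have "B \<inter> Z \<noteq> {}" using t(2) B(2,4) closure_iff_nhds_not_empty by blast
    then have "f \<alpha> b = 0" if "b \<in> B" for b
      using holo_zero_on_convex[OF holo_on_subset[OF holo[OF B(1)] B(5)] B(3,2), of "B \<inter> Z" b]
        B \<open>open Z\<close> \<open>Z \<subseteq> N\<close> zeros that by blast
    then have "B \<subseteq> N" using zeros B(1,5) by blast
    then show ?thesis using B cover(2) unfolding Z_def by blast
  qed
  then have "Z = \<D> \<inter> closure Z" using \<open>Z \<subseteq> \<D>\<close> closure_subset by blast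
  then have "closedin (top_of_set \<D>) Z" unfolding closedin_closed by (metis closed_closure)
  moreover have "openin (top_of_set \<D>) Z"
    using \<open>open Z\<close> \<open>Z \<subseteq> \<D>\<close> by (simp add: open_subset)
  ultimately have "Z = {} \<or> Z = \<D>"
    using \<open>connected \<D>\<close> unfolding connected_clopen by blast
  moreover have "Z \<noteq> \<D>"
  proof
    assume "Z = \<D>"
    obtain \<alpha> where "\<alpha> \<in> I" using \<open>\<D> \<noteq> {}\<close> cover(2) by blast
    moreover then obtain t where "t \<in> D \<alpha>" "f \<alpha> t \<noteq> 0" using nontrivial by blast
    ultimately show False using zeros \<open>Z \<subseteq> N\<close> \<open>Z = \<D>\<close> cover(2) by blast
  qed
  ultimately have "Z = {}" by blast
  then have nowhere_dense: "W = {}" if "open W" "W \<subseteq> \<D>" "W \<subseteq> N" for W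
    using that unfolding Z_def by blast
  have "connected (\<D> - N)"
  proof (rule connected_diff_nowhere_dense[OF \<open>open \<D>\<close> \<open>connected \<D>\<close> _ nowhere_dense op])
    fix t assume "t \<in> \<D>"
    then obtain \<alpha> B where B: "\<alpha> \<in> I" "open B" "convex B" "t \<in> B" "B \<subseteq> D \<alpha>" using ball by blast
    have "B - N = B - {t. f \<alpha> t = 0}" using zeros B(1,5) by blast
    moreover have "connected (B - {t. f \<alpha> t = 0})"
      by (rule connected_convex_minus_zeros[OF holo_on_subset[OF holo[OF B(1)] B(5)] B(3,2)])
    ultimately show "\<exists>B. open B \<and> t \<in> B \<and> B \<subseteq> \<D> \<and> connected (B - N)"
      using B cover(2) by (intro exI[of _ B]) auto
  qed
  moreover have "\<D> - N \<noteq> {}" using nowhere_dense[of \<D>] \<open>open \<D>\<close> \<open>\<D> \<noteq> {}\<close> by blast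
  ultimately show ?thesis using op by (simp add: is_domain_def)
qed

section \<open>Change of chart and the holomorphic family\<close>

lemma diagonal_invertible_nonzero:
  fixes E :: "complex ^ 'n ^ 'n"
  assumes "diagonal E" "invertible E"
  shows "E $ k $ k \<noteq> 0"
proof -
  have "det E = (\<Prod>k\<in>UNIV. E $ k $ k)"
    using assms(1) by (intro det_diagonal) (simp add: diagonal_def)
  moreover have "det E \<noteq> 0" using assms(2) by (simp add: invertible_det_nz)
  ultimately show ?thesis by simp
qed

text \<open>The diagonal factor is absorbed into the complementary row of each residue.\<close>

lemma left_pole_semiresidual_rescale:
  assumes "left_pole_semiresidual R A F" "diagonal E" "invertible E"
  shows "left_pole_semiresidual R A (F ** E)"
  unfolding left_pole_semiresidual_def
proof
  fix k
  obtain g where g: "mat_residue R (A $ k $ k) = (\<chi> i j. F $ i $ k * g $ j)"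
    using assms(1) unfolding left_pole_semiresidual_def by blast
  have "(F ** E) $ i $ k = F $ i $ k * E $ k $ k" for i
    using arg_cong[OF diagonal_imp_diag_mat[OF assms(2)], of "\<lambda>E. (F ** E) $ i $ k"]
    unfolding mult_diag_mat_nth .
  then have "mat_residue R (A $ k $ k) = (\<chi> i j. (F ** E) $ i $ k * (\<chi> j. g $ j / E $ k $ k) $ j)"
    using g diagonal_invertible_nonzero[OF assms(2,3), of k] by (simp add: vec_eq_iff)
  then show "\<exists>g. mat_residue R (A $ k $ k) = (\<chi> i j. (F ** E) $ i $ k * g $ j)" by blast
qed

lemma right_zero_semiresidual_rescale:
  assumes "right_zero_semiresidual R A G" "diagonal E" "invertible E"
  shows "right_zero_semiresidual R A (E ** G)"
  unfolding right_zero_semiresidual_def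
proof
  fix k
  obtain f where f: "mat_residue (mat_inverse R) (A $ k $ k) = (\<chi> i j. f $ i * G $ k $ j)"
    using assms(1) unfolding right_zero_semiresidual_def by blast
  have "(E ** G) $ k $ j = E $ k $ k * G $ k $ j" for j
    using arg_cong[OF diagonal_imp_diag_mat[OF assms(2)], of "\<lambda>E. (E ** G) $ k $ j"]
    unfolding diag_mat_mult_nth .
  then have "mat_residue (mat_inverse R) (A $ k $ k)
      = (\<chi> i j. (\<chi> i. f $ i / E $ k $ k) $ i * (E ** G) $ k $ j)"
    using f diagonal_invertible_nonzero[OF assms(2,3), of k] by (simp add: vec_eq_iff)
  then show "\<exists>f. mat_residue (mat_inverse R) (A $ k $ k) = (\<chi> i j. f $ i * (E ** G) $ k $ j)" by blast
qed

lemma mat_holo_on_coupling: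
  assumes "mat_holo_on F U" "mat_holo_on G U" "open U" "U \<subseteq> C_star"
  shows "mat_holo_on (coupling F G) U"
  unfolding mat_holo_on_def
proof (intro allI)
  fix i j
  have "holo_on (\<lambda>t. (G t ** F t) $ i $ j / (t $ Inr i - t $ Inl j)) U"
    by (intro holo_on_divide holo_on_matrix_mult_nth assms holo_on_diff holo_on_coordinate)
      (use assms(4) in \<open>auto simp: C_star_def\<close>)
  then show "holo_on (\<lambda>t. coupling F G t $ i $ j) U"
    by (rule holo_on_cong[OF _ assms(3)]) (use assms(4) in \<open>auto intro: coupling_nth\<close>)
qed

theorem theorem15p3:
  fixes \<D> :: "(complex ^ ('n::finite + 'n)) set"
    and I :: "'a set"
    and D :: "'a \<Rightarrow> (complex ^ ('n + 'n)) set"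
    and F :: "'a \<Rightarrow> complex ^ ('n + 'n) \<Rightarrow> complex ^ 'n ^ ('m::finite)"
    and G :: "'a \<Rightarrow> complex ^ ('n + 'n) \<Rightarrow> complex ^ 'm ^ 'n"
    and \<Gamma> :: "(complex ^ ('n + 'n)) set"
    and S :: "'a \<Rightarrow> complex ^ ('n + 'n) \<Rightarrow> complex ^ 'n ^ 'n"
  assumes domain: "is_domain \<D>" "\<D> \<subseteq> C_star"
    and covering: "finite I" "\<And>\<alpha>. \<alpha> \<in> I \<Longrightarrow> open (D \<alpha>)" "(\<Union>\<alpha>\<in>I. D \<alpha>) = \<D>"
    and holomorphic:
      "\<And>\<alpha>. \<alpha> \<in> I \<Longrightarrow> mat_holo_on (F \<alpha>) (D \<alpha>)"
      "\<And>\<alpha>. \<alpha> \<in> I \<Longrightarrow> mat_holo_on (G \<alpha>) (D \<alpha>)"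
    and compatible:
      "\<And>\<alpha> \<beta>. \<alpha> \<in> I \<Longrightarrow> \<beta> \<in> I \<Longrightarrow> D \<alpha> \<inter> D \<beta> \<noteq> {} \<Longrightarrow>
         \<exists>Dr Dc :: complex ^ ('n + 'n) \<Rightarrow> complex ^ 'n ^ 'n.
           mat_holo_on Dr (D \<alpha> \<inter> D \<beta>) \<and> mat_holo_on Dc (D \<alpha> \<inter> D \<beta>) \<and>
           (\<forall>t \<in> D \<alpha> \<inter> D \<beta>.
              diagonal (Dr t) \<and> invertible (Dr t) \<and> diagonal (Dc t) \<and> invertible (Dc t) \<and>
              F \<beta> t = F \<alpha> t ** Dc t \<and> G \<beta> t = Dr t ** G \<alpha> t)"
    and admissible: "ZP_admissible I D F G"
    and S_def: "S = (\<lambda>\<alpha>. coupling (F \<alpha>) (G \<alpha>))"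
    and \<Gamma>_def: "\<Gamma> = ZP_singular_set I D F G"
  shows "\<exists>R :: complex ^ ('n + 'n) \<Rightarrow> complex \<Rightarrow> complex ^ 'm ^ 'm.
    family_with_semiresiduals I D (\<D> - \<Gamma>) F G R \<and>
    (\<forall>R'. family_with_semiresiduals I D (\<D> - \<Gamma>) F G R' \<longrightarrow> (\<forall>t \<in> \<D> - \<Gamma>. R' t = R t)) \<and>
    (\<forall>\<alpha>\<in>I. \<forall>t \<in> D \<alpha> - \<Gamma>. \<forall>z. (\<forall>k. z \<noteq> t $ Inl k) \<longrightarrow>
       R t z = mat 1 - F \<alpha> t ** matrix_inv (mat z - A_P t) ** matrix_inv (S \<alpha> t) ** G \<alpha> t) \<and>
    (\<forall>\<alpha>\<in>I. \<forall>t \<in> D \<alpha> - \<Gamma>. \<forall>z. (\<forall>k. z \<noteq> t $ k) \<longrightarrow>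
       z_derivative (R t) z ** matrix_inv (R t z) =
         F \<alpha> t ** matrix_inv (mat z - A_P t) ** matrix_inv (S \<alpha> t)
           ** matrix_inv (mat z - A_Z t) ** G \<alpha> t)"
proof -
  have D_sub: "D \<alpha> \<subseteq> C_star" if "\<alpha> \<in> I" for \<alpha> using that covering(3) domain(2) by blast
  have rescale: "\<exists>E' E. diagonal E' \<and> invertible E' \<and> diagonal E \<and> invertible E
      \<and> F \<beta> t = F \<alpha> t ** E \<and> G \<beta> t = E' ** G \<alpha> t"
    if "\<alpha> \<in> I" "\<beta> \<in> I" "t \<in> D \<alpha>" "t \<in> D \<beta>" for \<alpha> \<beta> t
    using compatible[OF that(1,2)] that(3,4) by blast
  have det_zero: "det (S \<beta> t) = 0" if "\<alpha> \<in> I" "\<beta> \<in> I" "t \<in> D \<alpha>" "t \<in> D \<beta>" "det (S \<alpha> t) = 0" for \<alpha> \<beta> t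
  proof -
    from rescale[OF that(1-4)]
    obtain E' E where E: "diagonal E'" "diagonal E" "F \<beta> t = F \<alpha> t ** E" "G \<beta> t = E' ** G \<alpha> t"
      by blast
    have "S \<beta> t = E' ** S \<alpha> t ** E"
      unfolding S_def by (rule coupling_rescale) (use E that D_sub in auto)
    then show ?thesis by (simp add: det_mul that(5))
  qed
  have \<Gamma>_iff: "t \<in> \<Gamma> \<longleftrightarrow> det (S \<alpha> t) = 0" if "\<alpha> \<in> I" "t \<in> D \<alpha>" for \<alpha> t
    using that det_zero[OF _ that(1) _ that(2)] unfolding \<Gamma>_def ZP_singular_set_def S_def by auto
  have S_holo: "mat_holo_on (S \<alpha>) (D \<alpha>)" if "\<alpha> \<in> I" for \<alpha>
    unfolding S_def by (intro mat_holo_on_coupling holomorphic covering D_sub that)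
  have dom: "is_domain (\<D> - \<Gamma>)"
  proof (rule is_domain_minus_local_zeros[OF domain(1) covering(2,3)])
    show "holo_on (\<lambda>t. det (S \<alpha> t)) (D \<alpha>)" if "\<alpha> \<in> I" for \<alpha>
      using S_holo[OF that] by (intro holo_on_det) (simp add: mat_holo_on_def)
    show "\<exists>t\<in>D \<alpha>. det (S \<alpha> t) \<noteq> 0" if "\<alpha> \<in> I" for \<alpha>
      using admissible that unfolding ZP_admissible_def S_def by blast
  qed (use \<Gamma>_iff in auto)
  then have open_dom: "open (\<D> - \<Gamma>)" by (simp add: is_domain_def)
  define p q :: "complex ^ ('n + 'n) \<Rightarrow> 'n \<Rightarrow> complex" where "p t k = t $ Inl k" and "q t k = t $ Inr k" for t k
  have AP: "A_P t = diag_mat (p t)" and AZ: "A_Z t = diag_mat (q t)" for t :: "complex ^ ('n + 'n)"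
    by (simp_all add: A_P_def A_Z_def p_def[abs_def] q_def[abs_def])
  have pq: "inj (p t)" "inj (q t)" "q t i \<noteq> p t j" if "t \<in> C_star" for t i j
    using that unfolding C_star_def inj_def p_def q_def by (auto, metis Inl_inject, metis Inr_inject)
  have lyap: "diag_mat (q t) ** S \<alpha> t - S \<alpha> t ** diag_mat (p t) = G \<alpha> t ** F \<alpha> t"
    if "\<alpha> \<in> I" "t \<in> D \<alpha>" for \<alpha> t
    unfolding S_def AP[symmetric] AZ[symmetric] using that D_sub by (intro coupling_lyapunov) auto
  \<comment> \<open>The sign is put into the right factor, so that the family has the shape \<open>realization p F H\<close>.\<close>
  define H where "H \<alpha> t = - (matrix_inv (S \<alpha> t) ** G \<alpha> t)" for \<alpha> t
  define member where "member \<alpha> t R \<longleftrightarrow> generic R \<and> has_pole_matrix R (A_P t) \<and> has_zero_matrix R (A_Z t)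
    \<and> left_pole_semiresidual R (A_P t) (F \<alpha> t) \<and> right_zero_semiresidual R (A_Z t) (G \<alpha> t)
    \<and> (R \<longlongrightarrow> mat 1) at_infinity" for \<alpha> t and R :: "complex \<Rightarrow> complex ^ 'm ^ 'm"
  define formula where "formula \<alpha> t R \<longleftrightarrow> (\<forall>z. (\<forall>k. z \<noteq> p t k) \<longrightarrow> R z = realization (p t) (F \<alpha> t) (H \<alpha> t) z)"
    for \<alpha> t R
  have member_unique: "R1 = R2" if "member \<alpha> t R1" "member \<alpha> t R2" for \<alpha> t R1 R2
    by (rule family_member_unique[where A = "A_P t" and B = "A_Z t" and F = "F \<alpha> t" and G = "G \<alpha> t"])
      (use that in \<open>auto simp: member_def\<close>)
  \<comment> \<open>In an overlap of two charts the semiresidual conditions of one chart imply those of the other.\<close>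
  have member_change: "member \<beta> t R"
    if "\<alpha> \<in> I" "\<beta> \<in> I" "t \<in> D \<alpha>" "t \<in> D \<beta>" "member \<alpha> t R" for \<alpha> \<beta> t R
    using rescale[OF that(1-4)] that(5) unfolding member_def
    by (metis left_pole_semiresidual_rescale right_zero_semiresidual_rescale)
  have exists: "\<exists>R. member \<alpha> t R \<and> formula \<alpha> t R" if "\<alpha> \<in> I" "t \<in> D \<alpha>" "t \<notin> \<Gamma>" for \<alpha> t
  proof -
    have "t \<in> C_star" using that D_sub by blast
    moreover have "det (S \<alpha> t) \<noteq> 0" using \<Gamma>_iff that by blast
    ultimately show ?thesis
      using realization_family_member[OF pq lyap[OF that(1,2)]]
      unfolding member_def formula_def AP AZ H_def by blast
  qed
  \<comment> \<open>By uniqueness, the function built in one chart coincides with that of every other chart.\<close>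
  have "\<exists>R. \<forall>\<alpha>\<in>I. t \<in> D \<alpha> \<longrightarrow> member \<alpha> t R \<and> formula \<alpha> t R" if t: "t \<in> \<D> - \<Gamma>" for t
  proof -
    obtain \<alpha> R where \<alpha>: "\<alpha> \<in> I" "t \<in> D \<alpha>" "member \<alpha> t R" using t covering(3) exists by blast
    have "member \<beta> t R \<and> formula \<beta> t R" if "\<beta> \<in> I" "t \<in> D \<beta>" for \<beta>
      using member_change[OF \<alpha>(1) that(1) \<alpha>(2) that(2) \<alpha>(3)] exists[OF that] member_unique t by blast
    then show ?thesis by blast
  qed
  then obtain R where R: "\<And>t \<alpha>. t \<in> \<D> - \<Gamma> \<Longrightarrow> \<alpha> \<in> I \<Longrightarrow> t \<in> D \<alpha> \<Longrightarrow> member \<alpha> t (R t) \<and> formula \<alpha> t (R t)"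
    by metis
  have R': "t \<in> D \<alpha> - \<Gamma> \<Longrightarrow> \<alpha> \<in> I \<Longrightarrow> (\<And>k. z \<noteq> p t k) \<Longrightarrow> R t z = realization (p t) (F \<alpha> t) (H \<alpha> t) z" for t \<alpha> z
    using R[of t \<alpha>] covering(3) unfolding formula_def by blast
  have R_holo: "\<exists>U. open U \<and> t0 \<in> U \<and> U \<subseteq> \<D> - \<Gamma> \<and> mat_holo_on (\<lambda>t. R t z) U"
    if t0: "t0 \<in> \<D> - \<Gamma>" and z: "\<forall>k. z \<noteq> t0 $ k" for t0 z
  proof -
    obtain \<alpha> where \<alpha>: "\<alpha> \<in> I" "t0 \<in> D \<alpha>" using t0 covering(3) by blast
    define U where "U = (\<D> - \<Gamma>) \<inter> D \<alpha> \<inter> (\<Inter>k. {t. p t k \<noteq> z})"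
    have "open {t. p t k \<noteq> z}" for k
      unfolding p_def by (intro open_Collect_neq continuous_intros)
    then have "open U"
      unfolding U_def by (intro open_Int open_INT open_dom covering(2) \<alpha>(1)) auto
    have "U \<subseteq> D \<alpha>" by (auto simp: U_def)
    have T: "mat_holo_on (\<lambda>t. matrix_inv (S \<alpha> t)) U"
      using S_holo[OF \<alpha>(1)] holo_on_subset[OF _ \<open>U \<subseteq> D \<alpha>\<close>] \<Gamma>_iff[OF \<alpha>(1)] \<open>open U\<close>
      by (intro mat_holo_on_matrix_inv) (auto simp: mat_holo_on_def U_def)
    have FG: "mat_holo_on (F \<alpha>) U" "mat_holo_on (G \<alpha>) U"
      using holomorphic[OF \<alpha>(1)] holo_on_subset[OF _ \<open>U \<subseteq> D \<alpha>\<close>] unfolding mat_holo_on_def by blast+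
    have H: "holo_on (\<lambda>t. H \<alpha> t $ k $ j) U" for k j
      using holo_on_uminus[OF holo_on_matrix_mult_nth[OF T FG(2)]] by (simp add: H_def)
    have F: "holo_on (\<lambda>t. F \<alpha> t $ i $ k) U" for i k
      using FG(1) by (simp add: mat_holo_on_def)
    have "holo_on (\<lambda>t. realization (p t) (F \<alpha> t) (H \<alpha> t) z $ i $ j) U" for i j
      unfolding realization_nth p_def
      by (intro holo_on_add holo_on_const holo_on_sum holo_on_divide holo_on_mult holo_on_diff
          holo_on_coordinate F H) (auto simp: U_def p_def)
    then have "holo_on (\<lambda>t. R t z $ i $ j) U" for i j
      by (rule holo_on_cong[OF _ \<open>open U\<close>]) (subst R'[of _ \<alpha>], auto simp: U_def \<alpha>(1))
    then show ?thesis
      using \<open>open U\<close> t0 z \<alpha>(2) by (intro exI[of _ U]) (auto simp: U_def p_def mat_holo_on_def)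
  qed
  have R_member: "generic (R t) \<and> has_pole_matrix (R t) (A_P t) \<and> has_zero_matrix (R t) (A_Z t)
      \<and> (R t \<longlongrightarrow> mat 1) at_infinity" if t: "t \<in> \<D> - \<Gamma>" for t
  proof -
    obtain \<alpha> where "\<alpha> \<in> I" "t \<in> D \<alpha>" using t covering(3) by blast
    then show ?thesis using R[OF t] unfolding member_def by simp
  qed
  have R_semiresidual: "left_pole_semiresidual (R t) (A_P t) (F \<alpha> t) \<and> right_zero_semiresidual (R t) (A_Z t) (G \<alpha> t)"
    if "t \<in> \<D> - \<Gamma>" "\<alpha> \<in> I" "t \<in> D \<alpha>" for \<alpha> t
    using R[OF that] unfolding member_def by simp
  have "\<D> - \<Gamma> \<subseteq> C_star" using domain(2) by blast
  then have "normalized_holomorphic_family (\<D> - \<Gamma>) R"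
    unfolding normalized_holomorphic_family_def using dom R_member R_holo by simp
  then have "family_with_semiresiduals I D (\<D> - \<Gamma>) F G R"
    unfolding family_with_semiresiduals_def using R_semiresidual by simp
  moreover have "R'' t = R t" if R'': "family_with_semiresiduals I D (\<D> - \<Gamma>) F G R''" and t: "t \<in> \<D> - \<Gamma>" for R'' t
  proof -
    obtain \<alpha> where \<alpha>: "\<alpha> \<in> I" "t \<in> D \<alpha>" using t covering(3) by blast
    have "member \<alpha> t (R'' t)"
      using R'' t \<alpha> unfolding member_def family_with_semiresiduals_def normalized_holomorphic_family_def by simp
    then show ?thesis using R[OF t \<alpha>] member_unique by blast
  qed
  moreover have "R t z = mat 1 - F \<alpha> t ** matrix_inv (mat z - A_P t) ** matrix_inv (S \<alpha> t) ** G \<alpha> t"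
    if "\<alpha> \<in> I" "t \<in> D \<alpha> - \<Gamma>" "\<forall>k. z \<noteq> t $ Inl k" for \<alpha> t z
  proof -
    have z: "z \<noteq> p t k" for k using that(3) by (simp add: p_def)
    show ?thesis
      unfolding AP resolvent_diag[of z "p t", OF z] R'[OF that(2,1) z] realization_def H_def
      by (simp add: matrix_minus_right matrix_mul_assoc)
  qed
  moreover have "z_derivative (R t) z ** matrix_inv (R t z) =
         F \<alpha> t ** matrix_inv (mat z - A_P t) ** matrix_inv (S \<alpha> t)
           ** matrix_inv (mat z - A_Z t) ** G \<alpha> t"
    if "\<alpha> \<in> I" "t \<in> D \<alpha> - \<Gamma>" "\<forall>k. z \<noteq> t $ k" for \<alpha> t z
  proof -
    have z: "z \<noteq> p t k" "z \<noteq> q t k" for k using that(3) by (simp_all add: p_def q_def)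
    have "S \<alpha> t ** matrix_inv (S \<alpha> t) = mat 1"
      using that \<Gamma>_iff by (intro matrix_inv_right_det) auto
    then show ?thesis
      unfolding AP AZ resolvent_diag[of z "p t", OF z(1)] resolvent_diag[of z "q t", OF z(2)]
      using that z R'[OF that(2,1)] unfolding H_def
      by (intro logarithmic_derivative_realization[OF lyap]) auto
  qed
  ultimately show ?thesis by (intro exI[of _ R]) blast
qed

end
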